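(* Let $k\in\mathbb{N}$, let $p>2$ be a prime, let $m\ge 1$ be an integer, and let $F$ be an infinite field of characteristic $0$ or $p$. Then the $\mathbb{Z}_2$-graded Gelfand-Kirillov dimension of $E_k$ in $m$ variables over $F$ is $$\mathrm{GKdim}_m^{\mathbb{Z}_2}(E_k)=m.$$
   Context: All algebras are associative and unitary. $E$ is the infinite dimensional unitary Grassmann algebra over $F$, generated by $e_1,e_2,\dots$ with relations $e_ie_j+e_je_i=0$ for all $i,j$; it has basis $\{e_{i_1}\cdots e_{i_n}\mid n\ge 0,\ i_1<\cdots<i_n\}$. $E_k$ denotes $E$ with the $\mathbb{Z}_2$-grading induced by $\deg(e_i)=0$ for $i=1,\dots,k$ and $\deg(e_i)=1$ otherwise (a monomial has degree the sum of the degrees of its factors). For a $\mathbb{Z}_2$-graded algebra $B=B^0\oplus B^1$, $T_{\mathbb{Z}_2}(B)$ is the ideal of $\mathbb{Z}_2$-graded polynomial identities of $B$, i.e. the polynomials in the free associative algebra on variables $y_i$ (degree $0$) and $z_i$ (degree $1$) vanishing whenever the $y_i$ are replaced by arbitrary elements of $B^0$ and the $z_i$ by arbitrary elements of $B^1$. The relatively-free $\mathbb{Z}_2$-graded algebra in $m$ variables is $$F_m^{\mathbb{Z}_2}(B)=F\langle y_1,\dots,y_m,z_1,\dots,z_m\rangle/\big(F\langle y_1,\dots,y_m,z_1,\dots,z_m\rangle\cap T_{\mathbb{Z}_2}(B)\big),$$ and $\mathrm{GKdim}_m^{\mathbb{Z}_2}(B):=\mathrm{GKdim}(F_m^{\mathbb{Z}_2}(B))$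 is its Gelfand-Kirillov dimension. *)

theory Defs
  imports
    "HOL-Algebra.Embedded_Algebras"
    "HOL-Algebra.QuotRing"
    "HOL-Computational_Algebra.Primes"
    "HOL-Library.Poly_Mapping"
    "HOL-Library.FSet"
    "HOL-Library.Extended_Real"
    "HOL-Library.Liminf_Limsup"
begin

section \<open>The free associative algebra\<close>

text \<open>
  Words form a monoid under concatenation, written additively (with empty word \<open>0\<close>), so that the
  monoid algebra \<open>'v word \<Rightarrow>\<^sub>0 'a\<close>, with the multiplication of
  \<^theory>\<open>HOL-Library.Poly_Mapping\<close>, is the free associative unitary algebra on \<open>'v\<close> over \<open>'a\<close>.
\<close>

datatype 'v word = Word (letters: "'v list")

instantiation word :: (type) monoid_add
begin
definition zero_word :: "'a word" where "zero_word = Word []"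
definition plus_word :: "'a word \<Rightarrow> 'a word \<Rightarrow> 'a word"
  where "plus_word v w = Word (letters v @ letters w)"
instance by standard (simp_all add: zero_word_def plus_word_def)
end

lemma letters_zero: "letters 0 = []"
  by (simp add: zero_word_def)

type_synonym ('v, 'a) free_algebra = "'v word \<Rightarrow>\<^sub>0 'a"

definition free_algebra_ring :: "'v set \<Rightarrow> ('v, 'a::ring_1) free_algebra ring" where
  "free_algebra_ring X =
    \<lparr>carrier = {f. \<forall>w\<in>Poly_Mapping.keys f. set (letters w) \<subseteq> X},
     monoid.mult = (*), one = 1, ring.zero = 0, add = (+)\<rparr>"

text \<open>Substitution in an algebra \<open>'b\<close> with scalar multiplication \<open>sc\<close>.\<close>

definition poly_eval :: "('a::zero \<Rightarrow> 'b \<Rightarrow> 'b::ring_1) \<Rightarrow> ('v \<Rightarrow> 'b) \<Rightarrow> ('v, 'a) free_algebra \<Rightarrow> 'b"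
  where
  "poly_eval sc \<rho> f = (\<Sum>w\<in>Poly_Mapping.keys f. sc (Poly_Mapping.lookup f w) (prod_list (map \<rho> (letters w))))"


section \<open>Gelfand-Kirillov dimension\<close>

text \<open>
  A unital algebra over a field is given by a ring \<open>R\<close> and a subfield \<open>K\<close> (the scalar multiples of
  one), as in \<^theory>\<open>HOL-Algebra.Embedded_Algebras\<close>. There \<^const>\<open>subalgebra\<close> is the notion of a
  \<open>K\<close>-linear subspace: it does not require closure under products.
\<close>

definition lin_span :: "('a, 'b) ring_scheme \<Rightarrow> 'a set \<Rightarrow> 'a set \<Rightarrow> 'a set" where
  "lin_span R K S = \<Inter> {W. subalgebra K W R \<and> S \<subseteq> W}"

text \<open>\<open>V\<^sup>0 + V\<^sup>1 + \<dots> + V\<^sup>n\<close>, where \<open>V\<^sup>i\<close> is spanned by the products of \<open>i\<close> elements of \<open>V\<close>.\<close>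

definition power_sum_space :: "('a, 'b) ring_scheme \<Rightarrow> 'a set \<Rightarrow> 'a set \<Rightarrow> nat \<Rightarrow> 'a set" where
  "power_sum_space R K V n =
     lin_span R K {foldr (\<otimes>\<^bsub>R\<^esub>) vs \<one>\<^bsub>R\<^esub> | vs. set vs \<subseteq> V \<and> length vs \<le> n}"

definition GKdim :: "('a, 'b) ring_scheme \<Rightarrow> 'a set \<Rightarrow> ereal" where
  "GKdim R K = (SUP V \<in> {V. ring.finite_dimension R K V}.
     limsup (\<lambda>n. ereal (log (real n) (real ((ring.dim R over K) (power_sum_space R K V n))))))"


section \<open>Graded identities and relatively free algebras\<close>

text \<open>A \<open>\<int>\<^sub>2\<close>-graded algebra is given by its scalar multiplication \<open>sc\<close> and its components \<open>B0\<close>, \<open>B1\<close>.\<close>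

datatype gvar = Y nat | Z nat

definition gvars :: "nat \<Rightarrow> gvar set" where
  "gvars m = Y ` {1..m} \<union> Z ` {1..m}"

definition T_Z2 ::
  "('a::zero \<Rightarrow> 'b \<Rightarrow> 'b::ring_1) \<Rightarrow> 'b set \<Rightarrow> 'b set \<Rightarrow> (gvar, 'a) free_algebra set" where
  "T_Z2 sc B0 B1 =
    {f. \<forall>\<rho>. (\<forall>i. \<rho> (Y i) \<in> B0) \<and> (\<forall>i. \<rho> (Z i) \<in> B1) \<longrightarrow> poly_eval sc \<rho> f = 0}"

definition rel_ideal ::
  "('a::ring_1 \<Rightarrow> 'b \<Rightarrow> 'b::ring_1) \<Rightarrow> 'b set \<Rightarrow> 'b set \<Rightarrow> nat \<Rightarrow> (gvar, 'a) free_algebra set" where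
  "rel_ideal sc B0 B1 m = carrier (free_algebra_ring (gvars m)) \<inter> T_Z2 sc B0 B1"

definition rel_free ::
  "('a::ring_1 \<Rightarrow> 'b \<Rightarrow> 'b::ring_1) \<Rightarrow> 'b set \<Rightarrow> 'b set \<Rightarrow> nat \<Rightarrow> (gvar, 'a) free_algebra set ring" where
  "rel_free sc B0 B1 m = free_algebra_ring (gvars m) Quot rel_ideal sc B0 B1 m"

text \<open>The copy of the base field inside the relatively free algebra: the classes of the constants.\<close>

definition rel_free_scalars ::
  "('a::ring_1 \<Rightarrow> 'b \<Rightarrow> 'b::ring_1) \<Rightarrow> 'b set \<Rightarrow> 'b set \<Rightarrow> nat \<Rightarrow> (gvar, 'a) free_algebra set set" where
  "rel_free_scalars sc B0 B1 m =
    range (\<lambda>c. rel_ideal sc B0 B1 m +>\<^bsub>free_algebra_ring (gvars m)\<^esub> Poly_Mapping.single 0 c)"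

definition GKdim_Z2 :: "('a::ring_1 \<Rightarrow> 'b \<Rightarrow> 'b::ring_1) \<Rightarrow> 'b set \<Rightarrow> 'b set \<Rightarrow> nat \<Rightarrow> ereal" where
  "GKdim_Z2 sc B0 B1 m = GKdim (rel_free sc B0 B1 m) (rel_free_scalars sc B0 B1 m)"


section \<open>The infinite dimensional Grassmann algebra\<close>

text \<open>
  The basis monomial \<open>e\<^bsub>i1\<^esub> \<cdots> e\<^bsub>in\<^esub>\<close> with \<open>i1 < \<dots> < in\<close> is represented by the finite set of its
  indices; \<open>gsign S T\<close> is the coefficient, \<open>0\<close> or \<open>\<plusminus>1\<close>, of the monomial of \<open>S \<union> T\<close> in the
  product of the monomials of \<open>S\<close> and \<open>T\<close>. Indices start at \<open>0\<close>.
\<close>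

definition gsign :: "nat fset \<Rightarrow> nat fset \<Rightarrow> 'a::ring_1" where
  "gsign S T = (if S |\<inter>| T = {||}
     then (- 1) ^ card {(i, j). i |\<in>| S \<and> j |\<in>| T \<and> j < i} else 0)"

definition gmult :: "(nat fset \<Rightarrow>\<^sub>0 'a) \<Rightarrow> (nat fset \<Rightarrow>\<^sub>0 'a) \<Rightarrow> (nat fset \<Rightarrow>\<^sub>0 'a::comm_ring_1)" where
  "gmult f g = (\<Sum>S\<in>Poly_Mapping.keys f. \<Sum>T\<in>Poly_Mapping.keys g. Poly_Mapping.single (S |\<union>| T) (Poly_Mapping.lookup f S * Poly_Mapping.lookup g T * gsign S T))"

lemma gmult_superset:
  assumes "finite A" "finite B" "Poly_Mapping.keys f \<subseteq> A" "Poly_Mapping.keys g \<subseteq> B"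
  shows "gmult f g = (\<Sum>S\<in>A. \<Sum>T\<in>B. Poly_Mapping.single (S |\<union>| T) (Poly_Mapping.lookup f S * Poly_Mapping.lookup g T * gsign S T))"
proof -
  have "(\<Sum>T\<in>Poly_Mapping.keys g. Poly_Mapping.single (S |\<union>| T) (Poly_Mapping.lookup f S * Poly_Mapping.lookup g T * gsign S T))
      = (\<Sum>T\<in>B. Poly_Mapping.single (S |\<union>| T) (Poly_Mapping.lookup f S * Poly_Mapping.lookup g T * gsign S T))" for S
    using assms by (intro sum.mono_neutral_left) (auto simp: in_keys_iff)
  then show ?thesis
    unfolding gmult_def using assms
    by (simp, intro sum.mono_neutral_left) (auto simp: in_keys_iff)
qed

lemma gmult_add_left: "gmult (f + f') g = gmult f g + gmult f' g"
proof -
  let ?A = "Poly_Mapping.keys f \<union> Poly_Mapping.keys f'"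
  have "gmult x g = (\<Sum>S\<in>?A. \<Sum>T\<in>Poly_Mapping.keys g. Poly_Mapping.single (S |\<union>| T)
      (Poly_Mapping.lookup x S * Poly_Mapping.lookup g T * gsign S T))" if "x \<in> {f, f', f + f'}" for x
    using that Poly_Mapping.keys_add[of f f'] by (intro gmult_superset) auto
  then show ?thesis
    by (simp add: lookup_add algebra_simps single_add sum.distrib)
qed

lemma gmult_add_right: "gmult f (g + g') = gmult f g + gmult f g'"
proof -
  let ?B = "Poly_Mapping.keys g \<union> Poly_Mapping.keys g'"
  have "gmult f x = (\<Sum>S\<in>Poly_Mapping.keys f. \<Sum>T\<in>?B. Poly_Mapping.single (S |\<union>| T)
      (Poly_Mapping.lookup f S * Poly_Mapping.lookup x T * gsign S T))" if "x \<in> {g, g', g + g'}" for x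
    using that Poly_Mapping.keys_add[of g g'] by (intro gmult_superset) auto
  then show ?thesis
    by (simp add: lookup_add algebra_simps single_add sum.distrib)
qed

lemma gmult_zero [simp]: "gmult 0 g = 0" "gmult f 0 = 0"
  by (simp_all add: gmult_def)

lemma gmult_single:
  "gmult (Poly_Mapping.single S a) (Poly_Mapping.single T b) = Poly_Mapping.single (S |\<union>| T) (a * b * gsign S T)"
  using gmult_superset[of "{S}" "{T}" "Poly_Mapping.single S a" "Poly_Mapping.single T b"] by simp

lemma poly_mapping_add_induct [case_names zero single add]:
  fixes f :: "'k \<Rightarrow>\<^sub>0 'a::comm_monoid_add"
  assumes "P 0" "\<And>x c. P (Poly_Mapping.single x c)" "\<And>f g. P f \<Longrightarrow> P g \<Longrightarrow> P (f + g)"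
  shows "P f"
proof -
  have "P (\<Sum>x\<in>A. Poly_Mapping.single x (Poly_Mapping.lookup f x))" for A
    by (induction A rule: infinite_finite_induct) (use assms in auto)
  moreover have
    "(\<Sum>x\<in>Poly_Mapping.keys f. Poly_Mapping.single x (Poly_Mapping.lookup f x)) = f"
    by (rule poly_mapping_eqI) (auto simp: lookup_sum lookup_single when_def in_keys_iff)
  ultimately show ?thesis by metis
qed

lemma gsign_empty [simp]: "gsign {||} T = 1" "gsign S {||} = 1"
  by (simp_all add: gsign_def)

lemma gsign_union_assoc:
  "(gsign S T * gsign (S |\<union>| T) U :: 'a::comm_ring_1) = gsign T U * gsign S (T |\<union>| U)"
proof (cases "S |\<inter>| T = {||} \<and> S |\<inter>| U = {||} \<and> T |\<inter>| U = {||}")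
  case True
  let ?I = "\<lambda>S T :: nat fset. {(i, j). i |\<in>| S \<and> j |\<in>| T \<and> j < i}"
  have fin: "finite (?I S T)" for S T
    by (rule finite_subset[of _ "fset S \<times> fset T"]) auto
  have 1: "?I (S |\<union>| T) U = ?I S U \<union> ?I T U" and 2: "?I S (T |\<union>| U) = ?I S T \<union> ?I S U"
    by auto
  have "card (?I (S |\<union>| T) U) = card (?I S U) + card (?I T U)"
    unfolding 1 using True by (intro card_Un_disjoint fin) auto
  moreover have "card (?I S (T |\<union>| U)) = card (?I S T) + card (?I S U)"
    unfolding 2 using True by (intro card_Un_disjoint fin) auto
  moreover have "(S |\<union>| T) |\<inter>| U = {||}" "S |\<inter>| (T |\<union>| U) = {||}"
    using True by (simp_all add: inf_sup_distrib1 inf_sup_distrib2)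
  ultimately show ?thesis
    using True by (simp add: gsign_def power_add mult_ac)
next
  case False
  then show ?thesis
    by (auto simp: gsign_def inf_sup_distrib1 inf_sup_distrib2)
qed

lemma gmult_assoc: "gmult (gmult f g) h = gmult f (gmult g h)"
proof (induction f rule: poly_mapping_add_induct)
  case (single S a)
  show ?case
  proof (induction g rule: poly_mapping_add_induct)
    case (single T b)
    show ?case
    proof (induction h rule: poly_mapping_add_induct)
      case (single U c)
      show ?case
        using gsign_union_assoc[of S T U, where 'a = 'a]
        by (simp add: gmult_single mult_ac sup_assoc)
    qed (simp_all add: gmult_add_right)
  qed (simp_all add: gmult_add_left gmult_add_right)
qed (simp_all add: gmult_add_left)

typedef (overloaded) 'a grassmann = "UNIV :: (nat fset \<Rightarrow>\<^sub>0 'a::zero) set"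
  morphisms coeffs of_coeffs
  by simp

setup_lifting type_definition_grassmann

instantiation grassmann :: (comm_ring_1) ring_1
begin

lift_definition zero_grassmann :: "'a grassmann" is 0 .
lift_definition one_grassmann :: "'a grassmann" is "Poly_Mapping.single {||} 1" .
lift_definition plus_grassmann :: "'a grassmann \<Rightarrow> 'a grassmann \<Rightarrow> 'a grassmann" is "(+)" .
lift_definition minus_grassmann :: "'a grassmann \<Rightarrow> 'a grassmann \<Rightarrow> 'a grassmann" is "(-)" .
lift_definition uminus_grassmann :: "'a grassmann \<Rightarrow> 'a grassmann" is uminus .
lift_definition times_grassmann :: "'a grassmann \<Rightarrow> 'a grassmann \<Rightarrow> 'a grassmann" is gmult .

instance
proof
  fix a b c :: "'a grassmann"
  show "a * b * c = a * (b * c)" by transfer (rule gmult_assoc)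
  show "(a + b) * c = a * c + b * c" by transfer (rule gmult_add_left)
  show "a * (b + c) = a * b + a * c" by transfer (rule gmult_add_right)
  show "1 * a = a"
  proof transfer
    fix f :: "nat fset \<Rightarrow>\<^sub>0 'a"
    show "gmult (Poly_Mapping.single {||} 1) f = f"
      by (induction f rule: poly_mapping_add_induct) (simp_all add: gmult_single gmult_add_right)
  qed
  show "a * 1 = a"
  proof transfer
    fix f :: "nat fset \<Rightarrow>\<^sub>0 'a"
    show "gmult f (Poly_Mapping.single {||} 1) = f"
      by (induction f rule: poly_mapping_add_induct) (simp_all add: gmult_single gmult_add_left)
  qed
  show "(0 :: 'a grassmann) \<noteq> 1"
    by transfer (metis lookup_single_eq lookup_zero zero_neq_one)
qed (transfer, simp add: algebra_simps)+

end

lift_definition gscale :: "'a::comm_ring_1 \<Rightarrow> 'a grassmann \<Rightarrow> 'a grassmann"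
  is "\<lambda>c. Poly_Mapping.map ((*) c)" .

lift_definition ggen :: "nat \<Rightarrow> 'a::comm_ring_1 grassmann"
  is "\<lambda>i. Poly_Mapping.single {|i|} 1" .

lift_definition gmonom :: "nat fset \<Rightarrow> 'a::comm_ring_1 grassmann"
  is "\<lambda>S. Poly_Mapping.single S 1" .

lemma ggen_anticommute: "ggen i * ggen j + ggen j * ggen i = 0"
proof (transfer fixing: i j)
  have *: "{(a, b). a = i \<and> b = j \<and> b < a} = (if j < i then {(i, j)} else {})" for i j :: nat
    by auto
  show "gmult (Poly_Mapping.single {|i|} 1) (Poly_Mapping.single {|j|} 1) +
        gmult (Poly_Mapping.single {|j|} 1) (Poly_Mapping.single {|i|} 1) = 0"
    by (cases i j rule: linorder_cases)
      (auto simp: gmult_single gsign_def * finsert_commute simp flip: single_add)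
qed

lemma prod_list_ggen:
  "sorted_wrt (<) is \<Longrightarrow> prod_list (map ggen is) = (gmonom (fset_of_list is) :: 'a::comm_ring_1 grassmann)"
proof (induction "is")
  case Nil
  show ?case by (simp add: one_grassmann_def gmonom_def)
next
  case (Cons i js)
  have "{(a, b). a |\<in>| {|i|} \<and> b |\<in>| fset_of_list js \<and> b < a} = {}"
    using Cons.prems by (force simp: fset_of_list_elem)
  moreover have "{|i|} |\<inter>| fset_of_list js = {||}"
    using Cons.prems by (force simp: fset_of_list_elem)
  ultimately have "gsign {|i|} (fset_of_list js) = (1 :: 'a)"
    unfolding gsign_def by (simp only: card.empty power_0 if_True simp_thms)
  then have "ggen i * gmonom (fset_of_list js) = (gmonom (finsert i (fset_of_list js)) :: 'a grassmann)"
    by (transfer fixing: i js) (simp add: gmult_single)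
  with Cons show ?case by simp
qed

text \<open>
  The grading of \<open>E\<^sub>k\<close>: the generators \<open>ggen 0, \<dots>, ggen (k - 1)\<close>, i.e. \<open>e\<^sub>1, \<dots>, e\<^sub>k\<close> when counting
  from \<open>1\<close>, have degree \<open>0\<close>, all the others have degree \<open>1\<close>.
\<close>

definition gdeg :: "nat \<Rightarrow> nat fset \<Rightarrow> nat" where
  "gdeg k S = card {i. i |\<in>| S \<and> k \<le> i}"

definition E_even :: "nat \<Rightarrow> 'a::comm_ring_1 grassmann set" where
  "E_even k = {x. \<forall>S\<in>Poly_Mapping.keys (coeffs x). even (gdeg k S)}"

definition E_odd :: "nat \<Rightarrow> 'a::comm_ring_1 grassmann set" where
  "E_odd k = {x. \<forall>S\<in>Poly_Mapping.keys (coeffs x). odd (gdeg k S)}"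

section \<open>Well-definedness\<close>

text \<open>
  The relatively free algebra of \<open>E\<^sub>k\<close> is a quotient of a ring by an ideal, and \<^const>\<open>rel_free_scalars\<close>
  is a subfield of it, as the vector space notions used in \<^const>\<open>GKdim\<close> require.
\<close>

lemma ring_free_algebra_ring: "ring (free_algebra_ring X :: ('v, 'a::ring_1) free_algebra ring)"
proof -
  let ?R = "free_algebra_ring X :: ('v, 'a) free_algebra ring"
  have add: "f + g \<in> carrier ?R" and uminus: "- f \<in> carrier ?R" and mult: "f * g \<in> carrier ?R"
    if "f \<in> carrier ?R" "g \<in> carrier ?R" for f g
  proof -
    show "f + g \<in> carrier ?R"
      using that Poly_Mapping.keys_add[of f g] by (auto simp: free_algebra_ring_def)
    show "- f \<in> carrier ?R"
      using that by (auto simp: free_algebra_ring_def in_keys_iff)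
    show "f * g \<in> carrier ?R"
      using that keys_mult[of f g] by (fastforce simp: free_algebra_ring_def plus_word_def)
  qed
  have 1: "0 \<in> carrier ?R" "1 \<in> carrier ?R"
    by (auto simp: free_algebra_ring_def zero_word_def)
  have ops: "f \<oplus>\<^bsub>?R\<^esub> g = f + g" "f \<otimes>\<^bsub>?R\<^esub> g = f * g" "\<zero>\<^bsub>?R\<^esub> = 0" "\<one>\<^bsub>?R\<^esub> = 1" for f g
    by (simp_all add: free_algebra_ring_def)
  show ?thesis
  proof (rule ringI)
    show "abelian_group ?R"
    proof (rule abelian_groupI)
      fix f assume "f \<in> carrier ?R"
      then show "\<exists>g\<in>carrier ?R. g \<oplus>\<^bsub>?R\<^esub> f = \<zero>\<^bsub>?R\<^esub>"
        by (intro bexI[of _ "- f"]) (simp_all add: ops uminus)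
    qed (simp_all add: ops add 1 ac_simps)
    show "Group.monoid ?R"
      by (rule monoidI) (simp_all add: ops mult 1 mult.assoc)
  qed (simp_all add: ops algebra_simps)
qed

lemma gscale_add_left: "gscale (a + b) x = gscale a x + gscale b x"
  by transfer (rule poly_mapping_eqI, simp add: lookup_add Poly_Mapping.map.rep_eq when_def algebra_simps)

lemma gscale_add_right: "gscale a (x + y) = gscale a x + gscale a y"
  by transfer (rule poly_mapping_eqI, simp add: lookup_add Poly_Mapping.map.rep_eq when_def flip: distrib_left)

lemma gscale_zero [simp]: "gscale 0 x = 0" "gscale a 0 = 0"
  by (transfer, rule poly_mapping_eqI, simp add: Poly_Mapping.map.rep_eq when_def)+

lemma gscale_one [simp]: "gscale 1 x = x"
  by transfer (rule poly_mapping_eqI, simp add: Poly_Mapping.map.rep_eq when_def)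

lemma gscale_mult: "gscale a x * gscale b y = gscale (a * b) (x * y)"
proof (transfer fixing: a b)
  have *: "Poly_Mapping.map ((*) a) (f + g) = Poly_Mapping.map ((*) a) f + Poly_Mapping.map ((*) a) g"
    for a :: 'a and f g :: "nat fset \<Rightarrow>\<^sub>0 'a"
    by (rule poly_mapping_eqI) (simp add: lookup_add Poly_Mapping.map.rep_eq when_def flip: distrib_left)
  have 0: "Poly_Mapping.map ((*) a) 0 = (0 :: nat fset \<Rightarrow>\<^sub>0 'a)" for a :: 'a
    by (rule poly_mapping_eqI) (simp add: Poly_Mapping.map.rep_eq)
  fix x y :: "nat fset \<Rightarrow>\<^sub>0 'a"
  show "gmult (Poly_Mapping.map ((*) a) x) (Poly_Mapping.map ((*) b) y)
      = Poly_Mapping.map ((*) (a * b)) (gmult x y)"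
  proof (induction x rule: poly_mapping_add_induct)
    case (single S c)
    show ?case
    proof (induction y rule: poly_mapping_add_induct)
      case (single T d)
      show ?case by (simp add: gmult_single mult_ac)
    qed (simp_all add: * 0 gmult_add_right)
  qed (simp_all add: * 0 gmult_add_left)
qed

lemma poly_eval_superset:
  assumes "finite A" "Poly_Mapping.keys f \<subseteq> A"
  shows "poly_eval gscale \<rho> f =
    (\<Sum>w\<in>A. gscale (Poly_Mapping.lookup f w) (prod_list (map \<rho> (letters w))))"
  unfolding poly_eval_def using assms
  by (intro sum.mono_neutral_left) (auto simp: in_keys_iff)

lemma poly_eval_add: "poly_eval gscale \<rho> (f + g) = poly_eval gscale \<rho> f + poly_eval gscale \<rho> g"
proof -
  let ?A = "Poly_Mapping.keys f \<union> Poly_Mapping.keys g"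
  have "poly_eval gscale \<rho> x =
      (\<Sum>w\<in>?A. gscale (Poly_Mapping.lookup x w) (prod_list (map \<rho> (letters w))))"
    if "x \<in> {f, g, f + g}" for x
    using that Poly_Mapping.keys_add[of f g] by (intro poly_eval_superset) auto
  then show ?thesis
    by (simp add: lookup_add gscale_add_left sum.distrib)
qed

lemma poly_eval_zero [simp]: "poly_eval gscale \<rho> 0 = 0"
  by (simp add: poly_eval_def)

lemma poly_eval_single:
  "poly_eval gscale \<rho> (Poly_Mapping.single w c) = gscale c (prod_list (map \<rho> (letters w)))"
  using poly_eval_superset[of "{w}" "Poly_Mapping.single w c"] by simp

lemma poly_eval_mult: "poly_eval gscale \<rho> (f * g) = poly_eval gscale \<rho> f * poly_eval gscale \<rho> g"
proof (induction f rule: poly_mapping_add_induct)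
  case (single v a)
  show ?case
  proof (induction g rule: poly_mapping_add_induct)
    case (single w b)
    show ?case
      by (simp add: mult_single poly_eval_single gscale_mult plus_word_def)
  qed (simp_all add: poly_eval_add distrib_left)
qed (simp_all add: poly_eval_add distrib_right)

lemma poly_eval_uminus: "poly_eval gscale \<rho> (- f) = - poly_eval gscale \<rho> f"
  using poly_eval_add[of \<rho> f "- f"] by (simp add: eq_neg_iff_add_eq_0 add.commute)

lemma ideal_rel_ideal: "ideal (rel_ideal gscale B0 B1 m) (free_algebra_ring (gvars m))"
proof -
  let ?R = "free_algebra_ring (gvars m) :: (gvar, 'a) free_algebra ring"
  interpret ring ?R by (rule ring_free_algebra_ring)
  have ops: "f \<oplus>\<^bsub>?R\<^esub> g = f + g" "f \<otimes>\<^bsub>?R\<^esub> g = f * g" "\<zero>\<^bsub>?R\<^esub> = 0" for f g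
    by (simp_all add: free_algebra_ring_def)
  have neg: "\<ominus>\<^bsub>?R\<^esub> f = - f" if "f \<in> carrier ?R" for f
    using r_neg[OF that] by (simp add: ops eq_neg_iff_add_eq_0 add.commute)
  show ?thesis
  proof (rule idealI)
    show "subgroup (rel_ideal gscale B0 B1 m) (add_monoid ?R)"
    proof (rule add.subgroupI)
      have "0 \<in> rel_ideal gscale B0 B1 m"
        using zero_closed by (auto simp: rel_ideal_def T_Z2_def ops)
      then show "rel_ideal gscale B0 B1 m \<noteq> {}" by blast
    next
      fix f assume "f \<in> rel_ideal gscale B0 B1 m"
      then show "\<ominus>\<^bsub>?R\<^esub> f \<in> rel_ideal gscale B0 B1 m"
        using a_inv_closed[of f] neg[of f] by (auto simp: rel_ideal_def T_Z2_def poly_eval_uminus)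
    next
      fix f g assume "f \<in> rel_ideal gscale B0 B1 m" "g \<in> rel_ideal gscale B0 B1 m"
      then show "f \<oplus>\<^bsub>?R\<^esub> g \<in> rel_ideal gscale B0 B1 m"
        using a_closed[of f g] by (auto simp: rel_ideal_def T_Z2_def poly_eval_add ops)
    qed (auto simp: rel_ideal_def)
  next
    fix f g assume "f \<in> rel_ideal gscale B0 B1 m" "g \<in> carrier ?R"
    then show "g \<otimes>\<^bsub>?R\<^esub> f \<in> rel_ideal gscale B0 B1 m" "f \<otimes>\<^bsub>?R\<^esub> g \<in> rel_ideal gscale B0 B1 m"
      using m_closed[of f g] m_closed[of g f]
      by (auto simp: rel_ideal_def T_Z2_def poly_eval_mult ops)
  qed (rule ring_free_algebra_ring)
qed

lemma ring_rel_free: "ring (rel_free gscale B0 B1 m)"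
  unfolding rel_free_def by (rule ideal.quotient_is_ring[OF ideal_rel_ideal])

lemma subfield_rel_free_scalars:
  "subfield (rel_free_scalars (gscale :: 'a::field \<Rightarrow> _) (E_even k) (E_odd k) m)
     (rel_free gscale (E_even k) (E_odd k) m)"
proof -
  let ?R = "free_algebra_ring (gvars m) :: (gvar, 'a) free_algebra ring"
  let ?I = "rel_ideal (gscale :: 'a \<Rightarrow> _) (E_even k) (E_odd k) m"
  let ?c = "Poly_Mapping.single 0 :: 'a \<Rightarrow> (gvar, 'a) free_algebra"
  interpret R: ring ?R by (rule ring_free_algebra_ring)
  interpret ideal ?I ?R by (rule ideal_rel_ideal)
  interpret h: ring_hom_ring ?R "?R Quot ?I" "(+>\<^bsub>?R\<^esub>) ?I" by (rule rcos_ring_hom_ring)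
  have ops: "f \<oplus>\<^bsub>?R\<^esub> g = f + g" "f \<otimes>\<^bsub>?R\<^esub> g = f * g" "\<zero>\<^bsub>?R\<^esub> = 0" "\<one>\<^bsub>?R\<^esub> = 1" for f g
    by (simp_all add: free_algebra_ring_def)
  have closed: "?c a \<in> carrier ?R" for a
    by (auto simp: free_algebra_ring_def zero_word_def)
  have neg: "\<ominus>\<^bsub>?R\<^esub> f = - f" if "f \<in> carrier ?R" for f
    using R.r_neg[OF that] by (simp add: ops eq_neg_iff_add_eq_0 add.commute)
  have "subfield (range ?c) ?R"
  proof (rule R.subfieldI)
    show "subcring (range ?c) ?R"
    proof (intro R.subcringI R.subringI)
      fix x y assume "x \<in> range ?c" "y \<in> range ?c"
      then obtain a b where xy: "x = ?c a" "y = ?c b" by auto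
      show "\<ominus>\<^bsub>?R\<^esub> x \<in> range ?c"
        using neg[OF closed, of a] by (simp add: xy flip: single_uminus)
      show "x \<oplus>\<^bsub>?R\<^esub> y \<in> range ?c" by (simp add: xy ops flip: single_add)
      show "x \<otimes>\<^bsub>?R\<^esub> y \<in> range ?c" "x \<otimes>\<^bsub>?R\<^esub> y = y \<otimes>\<^bsub>?R\<^esub> x"
        by (simp_all add: xy ops mult_single mult.commute)
    next
      show "\<one>\<^bsub>?R\<^esub> \<in> range ?c"
        unfolding ops by (rule range_eqI[of _ _ 1]) simp
    qed (use closed in blast)
    have "?c a \<in> Units (?R\<lparr>carrier := range ?c\<rparr>) \<longleftrightarrow> (\<exists>b. ?c b * ?c a = 1 \<and> ?c a * ?c b = 1)" for a
      by (simp add: Units_def ops)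
    moreover have "(\<exists>b. ?c b * ?c a = 1 \<and> ?c a * ?c b = 1) \<longleftrightarrow> a \<noteq> 0" for a
    proof
      show "\<exists>b. ?c b * ?c a = 1 \<and> ?c a * ?c b = 1" if "a \<noteq> 0"
        using that by (intro exI[of _ "inverse a"]) (simp add: mult_single)
    qed auto
    ultimately have *: "?c a \<in> Units (?R\<lparr>carrier := range ?c\<rparr>) \<longleftrightarrow> a \<noteq> 0" for a
      by blast
    have c0: "?c a = 0 \<longleftrightarrow> a = 0" for a
      by (metis lookup_single_eq single_zero lookup_zero)
    show "Units (?R\<lparr>carrier := range ?c\<rparr>) = range ?c - {\<zero>\<^bsub>?R\<^esub>}"
    proof (rule Set.set_eqI)
      fix x
      show "x \<in> Units (?R\<lparr>carrier := range ?c\<rparr>) \<longleftrightarrow> x \<in> range ?c - {\<zero>\<^bsub>?R\<^esub>}"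
      proof (cases "x \<in> range ?c")
        case True
        then obtain a where "x = ?c a" by (rule rangeE)
        then show ?thesis using *[of a] c0[of a] by (simp add: ops)
      next
        case False
        then show ?thesis by (simp add: Units_def)
      qed
    qed
  qed
  moreover have "\<one>\<^bsub>?R Quot ?I\<^esub> \<noteq> \<zero>\<^bsub>?R Quot ?I\<^esub>"
  proof
    assume "\<one>\<^bsub>?R Quot ?I\<^esub> = \<zero>\<^bsub>?R Quot ?I\<^esub>"
    then have "?I +>\<^bsub>?R\<^esub> 1 = ?I" by (simp add: FactRing_def ops)
    then have "1 \<in> ?I"
      using a_rcos_self[of 1] R.one_closed by (simp add: ops)
    then have "poly_eval gscale (\<lambda>_. 0) (1 :: (gvar, 'a) free_algebra) = 0"
      by (auto simp: rel_ideal_def T_Z2_def E_even_def E_odd_def zero_grassmann.rep_eq)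
    then show False
      using poly_eval_single[of "\<lambda>_. 0" "0 :: gvar word" "1 :: 'a"] by (simp add: letters_zero)
  qed
  ultimately have "subfield ((+>\<^bsub>?R\<^esub>) ?I ` range ?c) (?R Quot ?I)"
    by (rule h.img_is_subfield(2))
  then show ?thesis
    by (simp add: rel_free_scalars_def rel_free_def image_image)
qed

end

theory Submission
  imports "HOL-Computational_Algebra.Polynomial" "HOL-Library.Function_Algebras" Defs
begin

text \<open>
  Every element of the Grassmann algebra \<open>E\<close> is the sum of a central part, of even length in the
  generators, and of a part of odd length; the odd parts anticommute and, as the characteristic
  is not \<open>2\<close>, have square zero. So, when graded elements are substituted for the variables, a word of
  length at most \<open>n\<close> expands into terms
    \<open>(\<Prod>v. c\<^sub>v ^ \<alpha> v) * (d\<^bsub>v1\<^esub> \<cdots> d\<^bsub>vr\<^esub>)\<close>,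
  where \<open>c\<^sub>v\<close> and \<open>d\<^sub>v\<close> are the central and the odd part of the value of \<open>v\<close>, where \<open>\<alpha> v \<le> n\<close>, and where
  \<open>v1, \<dots>, vr\<close> are distinct (\<open>word_in_span_normal_terms\<close>).

  The grading of \<open>E\<^sub>k\<close> enters through the variables \<open>z\<^sub>i\<close>. A monomial which has even length but is odd for
  the grading of \<open>E\<^sub>k\<close> contains one of the \<open>k\<close> generators of degree \<open>0\<close>; as no generator can be repeated,
  a product of \<open>k + 1\<close> such monomials vanishes (\<open>E_even_0_E_odd_nilpotent\<close>). Hence the exponents of
  the \<open>z\<^sub>i\<close> are at most \<open>k\<close>, only those of the \<open>m\<close> variables \<open>y\<^sub>i\<close> grow with \<open>n\<close>, and there are at
  most \<open>D * (n + 1) ^ m\<close> terms, with \<open>D\<close> depending on \<open>k\<close> and \<open>m\<close> only. An element of the relatively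
  free algebra is determined by its values under graded substitutions, so this number bounds the
  dimension of the space of classes of polynomials of degree at most \<open>n\<close>, and the
  Gelfand-Kirillov dimension is at most \<open>m\<close> (\<open>GKdim_le\<close>).

  Conversely, the \<open>y\<^sub>i\<close> may take arbitrary scalar values, and over an infinite field the commutative
  monomials in \<open>y\<^sub>1, \<dots>, y\<^sub>m\<close> are linearly independent functions of these values. There are at least
  \<open>(n / m) ^ m\<close> of them in degree at most \<open>n\<close>, so the dimension is at least \<open>m\<close> (\<open>GKdim_ge\<close>).
\<close>

section \<open>Supports and the canonical grading of the Grassmann algebra\<close>

lemma gscale_minus_one: "gscale (- 1) x = - x"
  using gscale_add_left[of 1 "- 1" x] by (simp add: eq_neg_iff_add_eq_0 add.commute)

lemma gscale_gscale: "gscale a (gscale b x) = gscale (a * b) x"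
  by transfer (rule poly_mapping_eqI, simp add: Poly_Mapping.map.rep_eq when_def mult.assoc)

lemma gscale_sum_left: "gscale (\<Sum>i\<in>A. c i) x = (\<Sum>i\<in>A. gscale (c i) x)"
  by (induction A rule: infinite_finite_induct) (simp_all add: gscale_add_left)

lift_definition grestrict :: "(nat fset \<Rightarrow> bool) \<Rightarrow> 'a::zero grassmann \<Rightarrow> 'a grassmann"
  is "\<lambda>P. Poly_Mapping.mapp (\<lambda>S c. c when P S)" .

lemma lookup_grestrict:
  "Poly_Mapping.lookup (coeffs (grestrict P x)) S = (Poly_Mapping.lookup (coeffs x) S when P S)"
  by (simp add: grestrict.rep_eq lookup_mapp when_def in_keys_iff)

lemma keys_grestrict:
  "Poly_Mapping.keys (coeffs (grestrict P x)) = {S \<in> Poly_Mapping.keys (coeffs x). P S}"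
  by (auto simp: in_keys_iff lookup_grestrict)

lemma grassmann_eqI:
  "(\<And>S. Poly_Mapping.lookup (coeffs x) S = Poly_Mapping.lookup (coeffs y) S) \<Longrightarrow> x = y"
  by (metis coeffs_inject poly_mapping_eqI)

lemma grestrict_add_not: "grestrict P x + grestrict (\<lambda>S. \<not> P S) x = (x :: 'a::comm_ring_1 grassmann)"
  by (rule grassmann_eqI) (simp add: plus_grassmann.rep_eq lookup_add lookup_grestrict when_def)

text \<open>
  A linear statement about the elements supported in \<open>P\<close> has to be checked on monomials only. This
  is how the commutation rules below are reduced to signs.
\<close>
lemma grassmann_support_induct [consumes 1, case_names zero monom add]:
  fixes x :: "'a::comm_ring_1 grassmann"
  assumes "\<forall>S\<in>Poly_Mapping.keys (coeffs x). P S"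
    and "Q 0" "\<And>S c. P S \<Longrightarrow> Q (gscale c (gmonom S))" "\<And>x y. Q x \<Longrightarrow> Q y \<Longrightarrow> Q (x + y)"
  shows "Q x"
proof -
  have "Q (\<Sum>S\<in>A. gscale (Poly_Mapping.lookup (coeffs x) S) (gmonom S))" if "A \<subseteq> Poly_Mapping.keys (coeffs x)" for A
    using finite_subset[OF that finite_keys] that
    by (induction A rule: finite_induct) (use assms in auto)
  moreover have "(\<Sum>S\<in>A. gscale (Poly_Mapping.lookup (coeffs x) S) (gmonom S))
     = of_coeffs (\<Sum>S\<in>A. Poly_Mapping.single S (Poly_Mapping.lookup (coeffs x) S))" for A
  proof (induction A rule: infinite_finite_induct)
    case (insert S A)
    have *: "gscale c (gmonom S) = of_coeffs (Poly_Mapping.single S c)" for c :: 'a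
      by (simp add: gscale_def gmonom_def of_coeffs_inverse)
    show ?case using insert by (simp add: * plus_grassmann_def of_coeffs_inverse)
  qed (simp_all add: zero_grassmann_def)
  moreover have "(\<Sum>S\<in>Poly_Mapping.keys f. Poly_Mapping.single S (Poly_Mapping.lookup f S)) = f"
    for f :: "nat fset \<Rightarrow>\<^sub>0 'a"
    by (rule poly_mapping_eqI) (auto simp: lookup_sum lookup_single when_def in_keys_iff)
  ultimately show ?thesis by (metis coeffs_inverse order_refl)
qed

lemma gmonom_mult:
  "gmonom S * gmonom T = (gscale (gsign S T) (gmonom (S |\<union>| T)) :: 'a::comm_ring_1 grassmann)"
  by transfer (simp add: gmult_single)

text \<open>
  For disjoint \<open>S\<close> and \<open>T\<close>, each of the \<open>fcard S * fcard T\<close> pairs is an inversion in exactly one of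
  the two products.
\<close>
lemma gsign_commute:
  "(gsign S T :: 'a::comm_ring_1) = (- 1) ^ (fcard S * fcard T) * gsign T S"
proof (cases "S |\<inter>| T = {||}")
  case True
  let ?I = "\<lambda>S T. {(i, j). i |\<in>| S \<and> j |\<in>| T \<and> j < (i :: nat)}"
  have fin: "finite (?I S T)" for S T
    by (rule finite_subset[of _ "fset S \<times> fset T"]) auto
  have "fset S \<times> fset T = ?I S T \<union> prod.swap ` ?I T S"
    using True by (force simp: image_iff)
  moreover have "?I S T \<inter> prod.swap ` ?I T S = {}" by auto
  ultimately have "card (fset S \<times> fset T) = card (?I S T) + card (prod.swap ` ?I T S)"
    using card_Un_disjoint[OF fin finite_imageI[OF fin]] by presburger
  moreover have "card (prod.swap ` ?I T S) = card (?I T S)"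
    by (intro card_image inj_onI) auto
  ultimately have "fcard S * fcard T + card (?I T S) = card (?I S T) + 2 * card (?I T S)"
    by (simp add: card_cartesian_product fcard.rep_eq)
  then have "(- 1 :: 'a) ^ (fcard S * fcard T + card (?I T S)) = (- 1) ^ (card (?I S T) + 2 * card (?I T S))"
    by (simp only:)
  then have "(- 1 :: 'a) ^ (fcard S * fcard T) * (- 1) ^ card (?I T S) = (- 1) ^ card (?I S T)"
    by (simp only: power_add power_minus1_even mult_1_right)
  with True show ?thesis by (simp add: gsign_def inf_commute)
qed (simp add: gsign_def inf_commute)

text \<open>
  For \<open>k = 0\<close> no generator has degree \<open>0\<close>, so \<open>E_even 0\<close> and \<open>E_odd 0\<close> are the components of the
  canonical grading by the parity of the length. It is compared below with the grading of \<open>E\<^sub>k\<close>.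
\<close>
lemma gdeg_0: "gdeg 0 S = fcard S"
  by (simp add: gdeg_def fcard.rep_eq)

lemma E_even_0_central:
  assumes "x \<in> E_even 0" shows "x * y = y * x"
proof -
  have "\<forall>S\<in>Poly_Mapping.keys (coeffs x). even (fcard S)"
    using assms by (simp add: E_even_def gdeg_0)
  then show ?thesis
  proof (induction x rule: grassmann_support_induct)
    case (monom S c)
    have "\<forall>S\<in>Poly_Mapping.keys (coeffs y). True" by simp
    then show ?case
    proof (induction y rule: grassmann_support_induct)
      case (monom T d)
      show ?case using \<open>even (fcard S)\<close> gsign_commute[of S T, where 'a = 'a]
        by (simp add: gscale_mult gmonom_mult mult.commute sup_commute)
    qed (simp_all add: distrib_left distrib_right)
  qed (simp_all add: distrib_left distrib_right)
qed

lemma E_odd_0_anticommute: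
  assumes "x \<in> E_odd 0" "y \<in> E_odd 0" shows "x * y = - (y * x)"
proof -
  have "\<forall>S\<in>Poly_Mapping.keys (coeffs x). odd (fcard S)" "\<forall>S\<in>Poly_Mapping.keys (coeffs y). odd (fcard S)"
    using assms by (simp_all add: E_odd_def gdeg_0)
  then show ?thesis
  proof (induction x rule: grassmann_support_induct)
    case (monom S c)
    from monom(2,1) show ?case
    proof (induction y rule: grassmann_support_induct)
      case (monom T d)
      then have "(gsign S T :: 'a) = - 1 * gsign T S"
        using gsign_commute[of S T, where 'a = 'a] by simp
      then have "gscale c (gmonom S) * gscale d (gmonom T) = gscale (- 1) (gscale d (gmonom T) * gscale c (gmonom S))"
        by (simp add: gscale_mult gmonom_mult gscale_gscale mult.commute sup_commute mult.left_commute)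
      then show ?case by (simp add: gscale_minus_one)
    qed (simp_all add: distrib_left distrib_right)
  qed (simp_all add: distrib_left distrib_right)
qed

lemma E_odd_0_square:
  fixes x :: "'a::field grassmann"
  assumes "x \<in> E_odd 0" "CHAR('a) \<noteq> 2" shows "x * x = 0"
proof -
  have "x * x + x * x = 0"
    using E_odd_0_anticommute[OF assms(1,1)] by (simp add: eq_neg_iff_add_eq_0)
  \<comment> \<open>Anticommutativity only gives \<open>2 * x * x = 0\<close>, so \<open>2\<close> has to be inverted.\<close>
  then have "gscale 2 (x * x) = 0"
    using gscale_add_left[of 1 1 "x * x"] by simp
  moreover have "(2 :: 'a) \<noteq> 0"
  proof
    assume "(2 :: 'a) = 0"
    then have "CHAR('a) dvd 2" using of_nat_eq_0_iff_char_dvd[where ?'a = 'a, of 2] by simp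
    then have "CHAR('a) = 1 \<or> CHAR('a) = 2"
      using two_is_prime_nat prime_nat_iff by blast
    then show False using assms(2) CHAR_not_1 by simp
  qed
  ultimately have "gscale (inverse 2) (gscale 2 (x * x)) = 0" "(inverse 2 * 2 :: 'a) = 1" by simp_all
  then show ?thesis by (simp only: gscale_gscale gscale_one)
qed

text \<open>
  The \<open>r\<close>-th term of the filtration of \<open>E\<close> by the number of generators of degree \<open>0\<close> in \<open>E\<^sub>k\<close>. There are
  \<open>k\<close> of these, so the filtration stops after \<open>r = k\<close>.
\<close>
definition low_degree_ge :: "nat \<Rightarrow> nat \<Rightarrow> 'a::comm_ring_1 grassmann set" where
  "low_degree_ge k r = {x. \<forall>S\<in>Poly_Mapping.keys (coeffs x). r \<le> card {i. i |\<in>| S \<and> i < k}}"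

lemma keys_times_grassmann:
  assumes "U \<in> Poly_Mapping.keys (coeffs (x * y))"
  obtains S T where "S \<in> Poly_Mapping.keys (coeffs x)" "T \<in> Poly_Mapping.keys (coeffs y)" "U = S |\<union>| T" "S |\<inter>| T = {||}"
proof -
  let ?t = "\<lambda>S T. Poly_Mapping.single (S |\<union>| T)
     (Poly_Mapping.lookup (coeffs x) S * Poly_Mapping.lookup (coeffs y) T * gsign S T)"
  have sub: "Poly_Mapping.keys (sum f A) \<subseteq> (\<Union>a\<in>A. Poly_Mapping.keys (f a))"
    for f :: "nat fset \<Rightarrow> nat fset \<Rightarrow>\<^sub>0 'a" and A by (rule keys_sum)
  have "U \<in> Poly_Mapping.keys (\<Sum>S\<in>Poly_Mapping.keys (coeffs x). \<Sum>T\<in>Poly_Mapping.keys (coeffs y). ?t S T)"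
    using assms by (simp add: times_grassmann.rep_eq gmult_def)
  then obtain S where S: "S \<in> Poly_Mapping.keys (coeffs x)"
      "U \<in> Poly_Mapping.keys (\<Sum>T\<in>Poly_Mapping.keys (coeffs y). ?t S T)"
    using sub by (meson UN_E subsetD)
  then obtain T where T: "T \<in> Poly_Mapping.keys (coeffs y)" "U \<in> Poly_Mapping.keys (?t S T)"
    using sub by (meson UN_E subsetD)
  from T(2) have "U = S |\<union>| T" "S |\<inter>| T = {||}" by (auto simp: gsign_def split: if_splits)
  with S(1) T(1) show thesis by (rule that)
qed

lemma low_degree_ge_mult:
  assumes "x \<in> low_degree_ge k r" "y \<in> low_degree_ge k s"
  shows "x * y \<in> low_degree_ge k (r + s)"
proof -
  have "r + s \<le> card {i. i |\<in>| U \<and> i < k}" if U: "U \<in> Poly_Mapping.keys (coeffs (x * y))" for U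
  proof -
    obtain S T where ST: "S \<in> Poly_Mapping.keys (coeffs x)" "T \<in> Poly_Mapping.keys (coeffs y)" "U = S |\<union>| T" "S |\<inter>| T = {||}"
      using keys_times_grassmann[OF U] .
    have "{i. i |\<in>| U \<and> i < k} = {i. i |\<in>| S \<and> i < k} \<union> {i. i |\<in>| T \<and> i < k}"
      using ST by auto
    moreover have "{i. i |\<in>| S \<and> i < k} \<inter> {i. i |\<in>| T \<and> i < k} = {}" using ST by auto
    ultimately have "card {i. i |\<in>| U \<and> i < k} = card {i. i |\<in>| S \<and> i < k} + card {i. i |\<in>| T \<and> i < k}"
      by (simp add: card_Un_disjoint)
    then show ?thesis using ST assms by (auto simp: low_degree_ge_def intro!: add_mono)
  qed
  then show ?thesis by (simp add: low_degree_ge_def)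
qed

text \<open>
  A monomial of \<open>x\<close> has an even number of generators, an odd number of which have degree \<open>1\<close> in \<open>E\<^sub>k\<close>;
  so at least one of them is among the \<open>k\<close> generators of degree \<open>0\<close>. The power \<open>x ^ (k + 1)\<close> would
  need \<open>k + 1\<close> distinct ones.
\<close>
lemma E_even_0_E_odd_nilpotent:
  assumes "x \<in> E_even 0" "x \<in> E_odd k"
  shows "x ^ Suc k = 0"
proof -
  have "x \<in> low_degree_ge k 1"
  proof -
    have "1 \<le> card {i. i |\<in>| S \<and> i < k}" if "S \<in> Poly_Mapping.keys (coeffs x)" for S
    proof -
      have "fset S = {i. i |\<in>| S \<and> i < k} \<union> {i. i |\<in>| S \<and> k \<le> i}" by auto
      moreover have "{i. i |\<in>| S \<and> i < k} \<inter> {i. i |\<in>| S \<and> k \<le> i} = {}" by auto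
      ultimately have "fcard S = card {i. i |\<in>| S \<and> i < k} + gdeg k S"
        unfolding fcard.rep_eq gdeg_def by (metis card_Un_disjoint finite_fset finite_Un)
      moreover have "even (fcard S)" "odd (gdeg k S)"
        using that assms by (auto simp: E_even_def E_odd_def gdeg_0)
      ultimately show ?thesis by (cases "card {i. i |\<in>| S \<and> i < k}") auto
    qed
    then show ?thesis by (simp add: low_degree_ge_def)
  qed
  then have "x ^ n \<in> low_degree_ge k n" for n
  proof (induction n)
    case 0 then show ?case by (simp add: low_degree_ge_def)
  next
    case (Suc n)
    then show ?case using low_degree_ge_mult[of x k 1 "x ^ n" n] by simp
  qed
  then have "x ^ Suc k \<in> low_degree_ge k (Suc k)" .
  moreover have "card {i. i |\<in>| S \<and> i < k} < Suc k" for S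
    using card_mono[of "{..<k}" "{i. i |\<in>| S \<and> i < k}"] by (auto simp: less_Suc_eq_le)
  ultimately have "S \<notin> Poly_Mapping.keys (coeffs (x ^ Suc k))" for S
    unfolding low_degree_ge_def mem_Collect_eq by (meson not_le)
  then have "Poly_Mapping.keys (coeffs (x ^ Suc k)) = {}" by blast
  then show ?thesis by (metis coeffs_inject keys_eq_empty zero_grassmann.rep_eq)
qed

abbreviation central_part :: "'a::comm_ring_1 grassmann \<Rightarrow> 'a grassmann" where
  "central_part \<equiv> grestrict (\<lambda>S. even (fcard S))"

abbreviation anti_part :: "'a::comm_ring_1 grassmann \<Rightarrow> 'a grassmann" where
  "anti_part \<equiv> grestrict (\<lambda>S. odd (fcard S))"

lemma central_part_add_anti_part: "central_part x + anti_part x = x"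
  by (rule grestrict_add_not)

lemma central_part_in_E_even_0: "central_part x \<in> E_even 0"
  by (simp add: E_even_def gdeg_0 keys_grestrict)

lemma anti_part_in_E_odd_0: "anti_part x \<in> E_odd 0"
  by (simp add: E_odd_def gdeg_0 keys_grestrict)

lemma grestrict_in_E_odd: "x \<in> E_odd k \<Longrightarrow> grestrict P x \<in> E_odd k"
  by (simp add: E_odd_def keys_grestrict)

section \<open>Normal forms of words under graded substitutions\<close>

lemma prod_list_eq_0: "0 \<in> set xs \<Longrightarrow> prod_list xs = (0 :: 'b::ring_1)"
  by (induction xs) auto

lemma prod_list_power_Suc:
  fixes c :: "'v \<Rightarrow> 'b::ring_1"
  assumes "\<And>u v. c u * c v = c v * c u" "distinct xs" "x \<in> set xs"
  shows "prod_list (map (\<lambda>v. c v ^ (\<alpha>(x := Suc (\<alpha> x))) v) xs) = c x * prod_list (map (\<lambda>v. c v ^ \<alpha> v) xs)"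
  using assms(2,3)
proof (induction xs)
  case (Cons v xs)
  show ?case
  proof (cases "v = x")
    case True
    then have "map (\<lambda>v. c v ^ (\<alpha>(x := Suc (\<alpha> x))) v) xs = map (\<lambda>v. c v ^ \<alpha> v) xs"
      using Cons.prems by (intro map_cong) auto
    then show ?thesis using True by (simp only: list.map prod_list.Cons fun_upd_same power_Suc mult.assoc)
  next
    case False
    have "c v ^ \<alpha> v * c x = c x * c v ^ \<alpha> v"
      by (rule power_commuting_commutes) (rule assms(1))
    then have "c v ^ \<alpha> v * (c x * prod_list (map (\<lambda>v. c v ^ \<alpha> v) xs))
        = c x * (c v ^ \<alpha> v * prod_list (map (\<lambda>v. c v ^ \<alpha> v) xs))"
      by (metis mult.assoc)
    with False Cons show ?thesis by simp
  qed
qed simp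

text \<open>
  Moving \<open>d x\<close> to the right as far as its other occurrence only changes signs, and there the square
  \<open>d x * d x\<close> appears.
\<close>
lemma prod_list_anticommute_repeated:
  fixes d :: "'v \<Rightarrow> 'b::ring_1"
  assumes "\<And>u v. d u * d v = - (d v * d u)" "\<And>u. d u * d u = 0" "x \<in> set L"
  shows "d x * prod_list (map d L) = 0"
  using assms(3)
proof (induction L)
  case (Cons v L)
  show ?case
  proof (cases "v = x")
    case True
    then show ?thesis using assms(2) by (simp flip: mult.assoc)
  next
    case False
    have "d x * (d v * prod_list (map d L)) = - (d v * (d x * prod_list (map d L)))"
      using assms(1)[of x v] by (simp flip: mult.assoc)
    with False Cons show ?thesis by simp
  qed
qed simp

definition graded_subst :: "nat \<Rightarrow> (gvar \<Rightarrow> 'a::comm_ring_1 grassmann) set" where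
  "graded_subst k = {\<rho>. (\<forall>i. \<rho> (Y i) \<in> E_even k) \<and> (\<forall>i. \<rho> (Z i) \<in> E_odd k)}"

definition fscale :: "'a::comm_ring_1 \<Rightarrow> ('r \<Rightarrow> 'a grassmann) \<Rightarrow> 'r \<Rightarrow> 'a grassmann" where
  "fscale c F = (\<lambda>\<rho>. gscale c (F \<rho>))"

interpretation fs: vector_space "fscale :: 'a::field \<Rightarrow> ('r \<Rightarrow> 'a grassmann) \<Rightarrow> 'r \<Rightarrow> 'a grassmann"
  by unfold_locales
    (simp_all add: fscale_def fun_eq_iff gscale_add_left gscale_add_right gscale_gscale)

text \<open>
  The value under a graded substitution of a product of central parts, with exponents \<open>\<alpha>\<close>, and of the
  anticommuting parts along \<open>L\<close>. The value \<open>0\<close> at other substitutions makes two such functions equal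
  exactly if they agree on the graded ones. Lists \<open>L\<close> in any order are used because sorting
  them would introduce signs, while without repetitions there are finitely many of them anyway.
\<close>
definition normal_term :: "nat \<Rightarrow> gvar list \<Rightarrow> (gvar \<Rightarrow> nat) \<Rightarrow> gvar list
    \<Rightarrow> (gvar \<Rightarrow> 'a::comm_ring_1 grassmann) \<Rightarrow> 'a grassmann" where
  "normal_term k xs \<alpha> L \<rho> = (if \<rho> \<in> graded_subst k
     then prod_list (map (\<lambda>v. central_part (\<rho> v) ^ \<alpha> v) xs) * prod_list (map (\<lambda>v. anti_part (\<rho> v)) L)
     else 0)"

text \<open>
  Exponents of \<open>z\<^sub>i\<close> are bounded by \<open>k\<close>, independently of \<open>n\<close>. This is what makes the growth \<open>n ^ m\<close>
  rather than \<open>n ^ (2 * m)\<close>.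
\<close>
definition exponents :: "nat \<Rightarrow> gvar set \<Rightarrow> nat \<Rightarrow> (gvar \<Rightarrow> nat) set" where
  "exponents k X n = PiE X (case_gvar (\<lambda>_. {..n}) (\<lambda>_. {..k}))"

definition normal_terms :: "nat \<Rightarrow> gvar list \<Rightarrow> nat \<Rightarrow> ((gvar \<Rightarrow> 'a::comm_ring_1 grassmann) \<Rightarrow> 'a grassmann) set" where
  "normal_terms k xs n = {normal_term k xs \<alpha> L | \<alpha> L.
     \<alpha> \<in> exponents k (set xs) n \<and> set L \<subseteq> set xs \<and> distinct L}"

text \<open>
  The exponent of \<open>x\<close> is raised by one. The value \<open>0\<close> occurs if \<open>x\<close> is a \<open>z\<^sub>i\<close> whose exponent was already
  \<open>k\<close>, by the nilpotency of its central part.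
\<close>
lemma normal_term_mult_central:
  assumes "distinct xs" "x \<in> set xs" "\<alpha> \<in> exponents k (set xs) n" "set L \<subseteq> set xs" "distinct L"
  shows "(\<lambda>\<rho>. central_part (\<rho> x) * normal_term k xs \<alpha> L \<rho>)
    \<in> insert 0 (normal_terms k xs (Suc n) :: ((gvar \<Rightarrow> 'a::field grassmann) \<Rightarrow> 'a grassmann) set)"
proof -
  let ?\<beta> = "\<alpha>(x := Suc (\<alpha> x))"
  have eq: "(\<lambda>\<rho> :: gvar \<Rightarrow> 'a grassmann. central_part (\<rho> x) * normal_term k xs \<alpha> L \<rho>) = normal_term k xs ?\<beta> L"
  proof
    fix \<rho> :: "gvar \<Rightarrow> 'a grassmann"
    have "prod_list (map (\<lambda>v. central_part (\<rho> v) ^ ?\<beta> v) xs)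
       = central_part (\<rho> x) * prod_list (map (\<lambda>v. central_part (\<rho> v) ^ \<alpha> v) xs)"
      by (rule prod_list_power_Suc[OF E_even_0_central[OF central_part_in_E_even_0] assms(1,2)])
    then show "central_part (\<rho> x) * normal_term k xs \<alpha> L \<rho> = normal_term k xs ?\<beta> L \<rho>"
      by (simp add: normal_term_def mult.assoc)
  qed
  show ?thesis
  proof (cases "\<exists>i. x = Z i \<and> \<alpha> x = k")
    case True
    then obtain i where i: "x = Z i" "\<alpha> x = k" by blast
    have "normal_term k xs ?\<beta> L \<rho> = 0" for \<rho> :: "gvar \<Rightarrow> 'a grassmann"
    proof (cases "\<rho> \<in> graded_subst k")
      case True
      then have "central_part (\<rho> x) ^ Suc k = 0"
        unfolding i graded_subst_def
        by (intro E_even_0_E_odd_nilpotent central_part_in_E_even_0 grestrict_in_E_odd) simp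
      then have "(\<lambda>v. central_part (\<rho> v) ^ ?\<beta> v) x = 0" using i by simp
      then have "0 \<in> set (map (\<lambda>v. central_part (\<rho> v) ^ ?\<beta> v) xs)" using assms(2)
        by (metis (no_types, lifting) image_eqI list.set_map)
      then show ?thesis unfolding normal_term_def by (simp only: prod_list_eq_0 mult_zero_left if_cancel)
    qed (simp add: normal_term_def)
    then have "normal_term k xs ?\<beta> L = (0 :: (gvar \<Rightarrow> 'a grassmann) \<Rightarrow> 'a grassmann)"
      by (simp add: fun_eq_iff)
    then show ?thesis unfolding eq by simp
  next
    case False
    then have "?\<beta> \<in> exponents k (set xs) (Suc n)"
      unfolding exponents_def
    proof (intro PiE_I)
      fix v assume v: "v \<in> set xs"
      then have "\<alpha> v \<in> case_gvar (\<lambda>_. {..n}) (\<lambda>_. {..k}) v"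
        using assms(3) unfolding exponents_def by (rule PiE_mem[rotated])
      with False show "?\<beta> v \<in> case_gvar (\<lambda>_. {..Suc n}) (\<lambda>_. {..k}) v"
        by (cases v) auto
    next
      fix v assume v: "v \<notin> set xs"
      then have "\<alpha> v = undefined"
        using assms(3) unfolding exponents_def by (rule PiE_arb[rotated])
      moreover have "v \<noteq> x" using v assms(2) by blast
      ultimately show "?\<beta> v = undefined" by simp
    qed
    then show ?thesis unfolding eq normal_terms_def using assms(4,5) by blast
  qed
qed

lemma exponents_mono: "n \<le> n' \<Longrightarrow> exponents k X n \<subseteq> exponents k X n'"
  unfolding exponents_def by (intro PiE_mono) (simp split: gvar.split)

lemma normal_terms_mono: "n \<le> n' \<Longrightarrow> normal_terms k xs n \<subseteq> normal_terms k xs n'"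
  unfolding normal_terms_def using exponents_mono[of n n' k "set xs"] by blast

text \<open>
  Central parts are passed over, so \<open>x\<close> is put in front of \<open>L\<close>. The product is \<open>0\<close> if \<open>x\<close> occurs in \<open>L\<close>.
\<close>
lemma normal_term_mult_anti:
  assumes "CHAR('a) \<noteq> 2" "x \<in> set xs" "\<alpha> \<in> exponents k (set xs) n" "set L \<subseteq> set xs" "distinct L"
  shows "(\<lambda>\<rho>. anti_part (\<rho> x) * normal_term k xs \<alpha> L \<rho>)
    \<in> insert 0 (normal_terms k xs n :: ((gvar \<Rightarrow> 'a::field grassmann) \<Rightarrow> 'a grassmann) set)"
proof -
  have comm: "anti_part (\<rho> x) * prod_list (map (\<lambda>v. central_part (\<rho> v) ^ \<alpha> v) ys)
     = prod_list (map (\<lambda>v. central_part (\<rho> v) ^ \<alpha> v) ys) * anti_part (\<rho> x)" for ys and \<rho> :: "gvar \<Rightarrow> 'a grassmann"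
  proof (induction ys)
    case (Cons v ys)
    have swap: "central_part (\<rho> v) ^ \<alpha> v * anti_part (\<rho> x) = anti_part (\<rho> x) * central_part (\<rho> v) ^ \<alpha> v"
      by (rule power_commuting_commutes) (rule E_even_0_central[OF central_part_in_E_even_0])
    have "anti_part (\<rho> x) * (central_part (\<rho> v) ^ \<alpha> v * b) = central_part (\<rho> v) ^ \<alpha> v * (anti_part (\<rho> x) * b)" for b
      by (simp only: mult.assoc[symmetric] swap)
    with Cons show ?case by (simp only: list.map prod_list.Cons mult.assoc)
  qed simp
  have eq: "anti_part (\<rho> x) * normal_term k xs \<alpha> L \<rho> = normal_term k xs \<alpha> (x # L) \<rho>" for \<rho> :: "gvar \<Rightarrow> 'a grassmann"
    using comm[of \<rho> xs] by (simp add: normal_term_def flip: mult.assoc)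
  show ?thesis
  proof (cases "x \<in> set L")
    case True
    have "anti_part (\<rho> x) * prod_list (map (\<lambda>v. anti_part (\<rho> v)) L) = 0" for \<rho> :: "gvar \<Rightarrow> 'a grassmann"
      by (rule prod_list_anticommute_repeated[OF E_odd_0_anticommute E_odd_0_square True])
         (rule anti_part_in_E_odd_0 assms(1))+
    then have "normal_term k xs \<alpha> (x # L) \<rho> = 0" for \<rho> :: "gvar \<Rightarrow> 'a grassmann"
      by (simp add: normal_term_def)
    then show ?thesis by (simp add: eq zero_fun_def)
  next
    case False
    then show ?thesis unfolding eq normal_terms_def using assms by force
  qed
qed

lemma mult_in_span:
  assumes "F \<in> fs.span S" "\<And>G. G \<in> S \<Longrightarrow> (\<lambda>\<rho>. u \<rho> * G \<rho>) \<in> fs.span T"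
  shows "(\<lambda>\<rho>. u \<rho> * F \<rho>) \<in> fs.span T"
  using assms(1)
proof (induction rule: fs.span_induct_alt)
  case base
  then show ?case using fs.span_zero[of T] by (simp add: zero_fun_def)
next
  case (step c x y)
  have "(\<lambda>\<rho>. u \<rho> * (fscale c x + y) \<rho>) = fscale c (\<lambda>\<rho>. u \<rho> * x \<rho>) + (\<lambda>\<rho>. u \<rho> * y \<rho>)"
    using gscale_mult[of 1 "u _" c "x _"] by (simp add: fun_eq_iff fscale_def distrib_left)
  then show ?case using step assms(2) by (simp add: fs.span_add fs.span_scale)
qed

text \<open>
  By induction on the word: a further letter \<open>x\<close> contributes the sum of its central and its
  anticommuting part, and multiplication by either preserves spans of normal terms.
\<close>
lemma word_in_span_normal_terms:
  assumes "CHAR('a::field) \<noteq> 2" "distinct xs" "set w \<subseteq> set xs"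
  shows "(\<lambda>\<rho>. if \<rho> \<in> graded_subst k then prod_list (map \<rho> w) else 0)
    \<in> fs.span (normal_terms k xs (length w) :: ((gvar \<Rightarrow> 'a grassmann) \<Rightarrow> 'a grassmann) set)"
  using assms(3)
proof (induction w)
  case Nil
  have eq: "(\<lambda>\<rho> :: gvar \<Rightarrow> 'a grassmann. if \<rho> \<in> graded_subst k then prod_list (map \<rho> []) else 0) = normal_term k xs (\<lambda>v\<in>set xs. 0) []"
  proof
    fix \<rho> :: "gvar \<Rightarrow> 'a grassmann"
    have "map (\<lambda>v. central_part (\<rho> v) ^ (\<lambda>v\<in>set xs. 0) v) xs = map (\<lambda>v. 1) xs"
      by (rule map_cong) auto
    moreover have "prod_list (map (\<lambda>v. 1 :: 'a grassmann) xs) = 1" by (induction xs) auto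
    ultimately show "(if \<rho> \<in> graded_subst k then prod_list (map \<rho> []) else 0) = normal_term k xs (\<lambda>v\<in>set xs. 0) [] \<rho>"
      unfolding normal_term_def by (simp only: list.map prod_list.Nil mult_1_right)
  qed
  have "(\<lambda>v\<in>set xs. 0) \<in> exponents k (set xs) 0"
    by (auto simp: exponents_def split: gvar.splits)
  then have "normal_term k xs (\<lambda>v\<in>set xs. 0) [] \<in> normal_terms k xs (length [])"
    unfolding normal_terms_def by force
  then show ?case unfolding eq by (rule fs.span_base)
next
  case (Cons x w)
  let ?F = "\<lambda>\<rho> :: gvar \<Rightarrow> 'a grassmann. if \<rho> \<in> graded_subst k then prod_list (map \<rho> w) else 0"
  let ?T = "normal_terms k xs (length (x # w)) :: ((gvar \<Rightarrow> 'a grassmann) \<Rightarrow> 'a grassmann) set"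
  have x: "x \<in> set xs" and F: "?F \<in> fs.span (normal_terms k xs (length w))" using Cons by simp_all
  have 0: "insert 0 ?T \<subseteq> fs.span ?T" by (simp add: fs.span_zero fs.span_superset)
  have "(\<lambda>\<rho>. central_part (\<rho> x) * ?F \<rho>) \<in> fs.span ?T"
    using F
  proof (rule mult_in_span)
    fix G :: "(gvar \<Rightarrow> 'a grassmann) \<Rightarrow> 'a grassmann" assume "G \<in> normal_terms k xs (length w)"
    then obtain \<alpha> L where "G = normal_term k xs \<alpha> L" "\<alpha> \<in> exponents k (set xs) (length w)"
      "set L \<subseteq> set xs" "distinct L"
      unfolding normal_terms_def by auto
    then show "(\<lambda>\<rho>. central_part (\<rho> x) * G \<rho>) \<in> fs.span ?T"
      using normal_term_mult_central[OF assms(2) x, of \<alpha> k "length w" L] 0 by auto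
  qed
  moreover have "(\<lambda>\<rho>. anti_part (\<rho> x) * ?F \<rho>) \<in> fs.span ?T"
    using F
  proof (rule mult_in_span)
    fix G :: "(gvar \<Rightarrow> 'a grassmann) \<Rightarrow> 'a grassmann" assume "G \<in> normal_terms k xs (length w)"
    then have "G \<in> normal_terms k xs (length (x # w))"
      using normal_terms_mono[of "length w" "length (x # w)"] by auto
    then obtain \<alpha> L where "G = normal_term k xs \<alpha> L" "\<alpha> \<in> exponents k (set xs) (length (x # w))"
      "set L \<subseteq> set xs" "distinct L"
      unfolding normal_terms_def by auto
    then show "(\<lambda>\<rho>. anti_part (\<rho> x) * G \<rho>) \<in> fs.span ?T"
      using normal_term_mult_anti[OF assms(1) x, of \<alpha> k "length (x # w)" L] 0 by auto
  qed
  ultimately have "(\<lambda>\<rho>. central_part (\<rho> x) * ?F \<rho>) + (\<lambda>\<rho>. anti_part (\<rho> x) * ?F \<rho>) \<in> fs.span ?T"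
    by (rule fs.span_add)
  moreover have "(\<lambda>\<rho>. central_part (\<rho> x) * ?F \<rho>) + (\<lambda>\<rho>. anti_part (\<rho> x) * ?F \<rho>)
     = (\<lambda>\<rho>. if \<rho> \<in> graded_subst k then prod_list (map \<rho> (x # w)) else 0)"
    by (simp add: fun_eq_iff central_part_add_anti_part flip: distrib_right)
  ultimately show ?case by simp
qed

definition gvar_list :: "nat \<Rightarrow> gvar list" where
  "gvar_list m = map Y [1..<Suc m] @ map Z [1..<Suc m]"

lemma set_gvar_list: "set (gvar_list m) = gvars m"
  unfolding gvar_list_def gvars_def by (simp del: upt_Suc add: atLeastLessThanSuc_atLeastAtMost)

lemma distinct_gvar_list: "distinct (gvar_list m)"
  unfolding gvar_list_def by (auto simp: distinct_map inj_on_def simp del: upt_Suc)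

lemma card_exponents:
  "card (exponents k (gvars m) n) = Suc n ^ m * Suc k ^ m"
proof -
  have "card (exponents k (gvars m) n) = (\<Prod>v\<in>gvars m. card (case v of Y _ \<Rightarrow> {..n} | Z _ \<Rightarrow> {..k}))"
    unfolding exponents_def by (rule card_PiE) (simp add: gvars_def)
  also have "\<dots> = (\<Prod>i\<in>{1..m}. Suc n) * (\<Prod>i\<in>{1..m}. Suc k)"
    unfolding gvars_def by (subst prod.union_disjoint) (auto simp: prod.reindex inj_on_def)
  finally show ?thesis by simp
qed

lemma normal_terms_finite_card:
  "\<exists>D. \<forall>n. finite (normal_terms k (gvar_list m) n :: ((gvar \<Rightarrow> 'a::comm_ring_1 grassmann) \<Rightarrow> 'a grassmann) set) \<and>
    card (normal_terms k (gvar_list m) n :: ((gvar \<Rightarrow> 'a::comm_ring_1 grassmann) \<Rightarrow> 'a grassmann) set) \<le> D * Suc n ^ m"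
proof (intro exI allI)
  fix n
  let ?L = "{L. set L \<subseteq> gvars m \<and> distinct L}"
  have fin: "finite ?L"
    by (rule finite_subset_distinct) (simp add: gvars_def)
  have finE: "finite (exponents k (gvars m) n)"
    unfolding exponents_def by (rule finite_PiE) (auto simp: gvars_def split: gvar.splits)
  have eq: "normal_terms k (gvar_list m) n = (\<lambda>(\<alpha>, L). normal_term k (gvar_list m) \<alpha> L) ` (exponents k (gvars m) n \<times> ?L)"
    unfolding normal_terms_def set_gvar_list by auto
  show "finite (normal_terms k (gvar_list m) n :: ((gvar \<Rightarrow> 'a grassmann) \<Rightarrow> 'a grassmann) set) \<and>
    card (normal_terms k (gvar_list m) n :: ((gvar \<Rightarrow> 'a grassmann) \<Rightarrow> 'a grassmann) set) \<le> (Suc k ^ m * card ?L) * Suc n ^ m"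
    unfolding eq using fin finE card_image_le[of "exponents k (gvars m) n \<times> ?L"]
    by (auto simp: card_cartesian_product card_exponents mult_ac)
qed

lemma sum_fun_apply: "(\<Sum>i\<in>A. F i) x = (\<Sum>i\<in>A. F i x :: 'b::comm_monoid_add)"
  by (induction A rule: infinite_finite_induct) simp_all

lemma poly_eval_sum: "poly_eval gscale \<rho> (\<Sum>i\<in>A. f i) = (\<Sum>i\<in>A. poly_eval gscale \<rho> (f i))"
  by (induction A rule: infinite_finite_induct) (simp_all add: poly_eval_add)

lemma poly_eval_const_mult:
  "poly_eval gscale \<rho> (Poly_Mapping.single 0 c * f) = gscale c (poly_eval gscale \<rho> f)"
  using gscale_mult[of c 1 1 "poly_eval gscale \<rho> f"]
  by (simp add: poly_eval_mult poly_eval_single letters_zero)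

lemma gscale_one_eq_0_iff: "gscale c (1 :: 'a::field grassmann) = 0 \<longleftrightarrow> c = 0"
proof
  assume "gscale c (1 :: 'a grassmann) = 0"
  then have "gscale (inverse c) (gscale c (1 :: 'a grassmann)) = 0" by simp
  then show "c = 0" by (cases "c = 0") (simp_all add: gscale_gscale)
qed simp

lemma zero_graded_subst: "(\<lambda>_. 0) \<in> graded_subst k"
  by (simp add: graded_subst_def E_even_def E_odd_def zero_grassmann.rep_eq)

lemma poly_eval_in_span_normal_terms:
  fixes f :: "(gvar, 'a::field) free_algebra"
  assumes "CHAR('a) \<noteq> 2" "distinct xs"
    and "\<And>w. w \<in> Poly_Mapping.keys f \<Longrightarrow> set (letters w) \<subseteq> set xs \<and> length (letters w) \<le> n"
  shows "(\<lambda>\<rho>. if \<rho> \<in> graded_subst k then poly_eval gscale \<rho> f else 0) \<in> fs.span (normal_terms k xs n)"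
proof -
  let ?F = "\<lambda>w (\<rho> :: gvar \<Rightarrow> 'a grassmann). if \<rho> \<in> graded_subst k then prod_list (map \<rho> (letters w)) else 0"
  have "(\<lambda>\<rho>. if \<rho> \<in> graded_subst k then poly_eval gscale \<rho> f else 0)
      = (\<Sum>w\<in>Poly_Mapping.keys f. fscale (Poly_Mapping.lookup f w) (?F w))"
    by (simp add: fun_eq_iff sum_fun_apply fscale_def poly_eval_def)
  also have "\<dots> \<in> fs.span (normal_terms k xs n)"
  proof (intro fs.span_sum fs.span_scale)
    fix w assume "w \<in> Poly_Mapping.keys f"
    then have "?F w \<in> fs.span (normal_terms k xs (length (letters w)))" "length (letters w) \<le> n"
      using word_in_span_normal_terms[OF assms(1,2)] assms(3) by blast+
    then show "?F w \<in> fs.span (normal_terms k xs n)"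
      using fs.span_mono[OF normal_terms_mono] by blast
  qed
  finally show ?thesis .
qed

section \<open>Linear independence by Kronecker substitution\<close>

lemma base_expansion:
  fixes q s :: nat
  shows "(\<Sum>j<m. s div q ^ j mod q * q ^ j) = s mod q ^ m"
proof (induction m)
  case (Suc m)
  have "s mod q ^ Suc m = q ^ m * (s div q ^ m mod q) + s mod q ^ m"
    using mod_mult2_eq[of s "q ^ m" q] by (simp add: mult.commute)
  with Suc show ?case by (simp add: mult.commute)
qed simp

text \<open>
  For \<open>s < q ^ m\<close>, these are the monomials \<open>y\<^sub>1 ^ a\<^sub>1 \<cdots> y\<^sub>m ^ a\<^sub>m\<close> with all \<open>a\<^sub>i < q\<close>, numbered by reading the
  exponents as the digits of \<open>s\<close> in base \<open>q\<close>, least significant digit first.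
\<close>
definition digit_word :: "nat \<Rightarrow> nat \<Rightarrow> nat \<Rightarrow> gvar word" where
  "digit_word m q s = Word (concat (map (\<lambda>j. replicate (s div q ^ j mod q) (Y (Suc j))) [0..<m]))"

lemma set_letters_digit_word: "set (letters (digit_word m q s)) \<subseteq> gvars m"
  by (auto simp: digit_word_def gvars_def)

lemma length_letters_digit_word:
  assumes "q > 0" shows "length (letters (digit_word m q s)) \<le> m * (q - 1)"
proof -
  have "(\<Sum>j<m. s div q ^ j mod q) \<le> (\<Sum>j<m. q - 1)"
    using assms by (intro sum_mono) (simp add: Suc_leI less_Suc_eq_le[symmetric])
  then show ?thesis
    by (simp add: digit_word_def length_concat comp_def interv_sum_list_conv_sum_set_nat atLeast0LessThan)
qed

text \<open>
  Kronecker's substitution: with \<open>y\<^sub>i\<close> replaced by the scalar \<open>t ^ (q ^ (i - 1))\<close>, the monomial with number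
  \<open>s\<close> becomes \<open>t ^ s\<close>. Linear independence of monomials in \<open>m\<close> variables is thereby reduced to the fact
  that a nonzero polynomial in one variable has finitely many roots.
\<close>
definition power_subst :: "nat \<Rightarrow> 'a::comm_ring_1 \<Rightarrow> gvar \<Rightarrow> 'a grassmann" where
  "power_subst q t v = (case v of Y i \<Rightarrow> gscale (t ^ (q ^ (i - 1))) 1 | Z _ \<Rightarrow> 0)"

lemma power_subst_graded: "power_subst q t \<in> graded_subst k"
proof -
  have "gscale c 1 \<in> E_even k" for c :: 'a
    by (auto simp: E_even_def gscale.rep_eq one_grassmann.rep_eq in_keys_iff Poly_Mapping.map.rep_eq
        lookup_single when_def gdeg_def split: if_splits)
  then show ?thesis
    by (simp add: graded_subst_def power_subst_def E_odd_def zero_grassmann.rep_eq)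
qed

lemma prod_list_power_subst:
  assumes "s < q ^ m"
  shows "prod_list (map (power_subst q t) (letters (digit_word m q s))) = gscale (t ^ s) (1 :: 'a::comm_ring_1 grassmann)"
proof -
  have pow: "gscale c (1 :: 'a grassmann) ^ r = gscale (c ^ r) 1" for c r
    by (induction r) (simp_all add: gscale_mult)
  have "prod_list (map (power_subst q t) (concat (map (\<lambda>j. replicate (s div q ^ j mod q) (Y (Suc j))) [0..<m])))
     = gscale (t ^ (\<Sum>j<m. s div q ^ j mod q * q ^ j)) (1 :: 'a grassmann)"
    by (induction m) (simp_all add: power_subst_def pow gscale_mult prod_list_replicate power_add
        mult.commute flip: power_mult)
  then show ?thesis using assms by (simp add: digit_word_def base_expansion)
qed

lemma infinite_field_poly_zero:
  fixes c :: "nat \<Rightarrow> 'a::field"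
  assumes "infinite (UNIV :: 'a set)" "\<And>t. (\<Sum>s<N. c s * t ^ s) = 0" "s < N"
  shows "c s = 0"
proof -
  let ?p = "\<Sum>s<N. Polynomial.monom (c s) s"
  have "poly ?p t = 0" for t using assms(2)[of t] by (simp add: poly_sum poly_monom)
  then have "?p = 0" using assms(1) poly_roots_finite[of ?p] by auto
  moreover have "Polynomial.coeff ?p s = c s" using assms(3) by (simp add: coeff_sum)
  ultimately show ?thesis by simp
qed

section \<open>Growth exponents\<close>

text \<open>
  A constant factor \<open>C\<close> contributes \<open>ln C / ln n\<close> to the logarithm to base \<open>n\<close>, which tends to \<open>0\<close>; so growth
  bounds are needed only up to constants.
\<close>
lemma tendsto_log_monomial:
  fixes C :: real
  assumes "C > 0"
  shows "(\<lambda>n. log (real n) (C * real n ^ m)) \<longlonglongrightarrow> real m"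
proof -
  have "filterlim (\<lambda>n. ln (real n)) at_top sequentially"
    by (rule filterlim_compose[OF ln_at_top filterlim_real_sequentially])
  then have "(\<lambda>n. ln C / ln (real n)) \<longlonglongrightarrow> 0"
    by (intro tendsto_divide_0[OF tendsto_const] filterlim_at_top_imp_at_infinity)
  then have "(\<lambda>n. ln C / ln (real n) + real m) \<longlonglongrightarrow> real m"
    using tendsto_add[OF _ tendsto_const] by fastforce
  moreover have "\<forall>\<^sub>F n in sequentially. ln C / ln (real n) + real m = log (real n) (C * real n ^ m)"
    using eventually_gt_at_top[of 1]
  proof eventually_elim
    case (elim n)
    then show ?case using assms
      by (simp add: log_def ln_mult ln_realpow field_simps)
  qed
  ultimately show ?thesis by (rule Lim_transform_eventually)
qed

lemma limsup_log_le:
  assumes "C \<ge> 1" "\<And>n. n \<ge> 1 \<Longrightarrow> real (a n) \<le> C * real n ^ m"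
  shows "limsup (\<lambda>n. ereal (log (real n) (real (a n)))) \<le> ereal (real m)"
proof -
  have "(\<lambda>n. ereal (log (real n) (C * real n ^ m))) \<longlonglongrightarrow> ereal (real m)"
    using tendsto_log_monomial[of C m] assms(1) by (simp add: tendsto_ereal)
  then have "limsup (\<lambda>n. ereal (log (real n) (C * real n ^ m))) = ereal (real m)"
    by (intro lim_imp_Limsup) simp_all
  moreover have "\<forall>\<^sub>F n in sequentially. ereal (log (real n) (real (a n))) \<le> ereal (log (real n) (C * real n ^ m))"
    using eventually_gt_at_top[of 1]
  proof eventually_elim
    case (elim n)
    show ?case
    proof (cases "a n = 0")
      case True
      \<comment> \<open>As \<open>ln 0 = 0\<close>, the left-hand side is \<open>0\<close> here; the hypothesis on \<open>C\<close> makes the right-hand side nonnegative.\<close>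
      have "1 \<le> C * real n ^ m" using assms(1) elim mult_mono[of 1 C 1 "real n ^ m"] by simp
      then have "0 \<le> log (real n) (C * real n ^ m)" using elim by simp
      then show ?thesis using True by (simp add: log_def)
    next
      case False
      then show ?thesis using elim assms(2)[of n] by simp
    qed
  qed
  ultimately show ?thesis using Limsup_mono by metis
qed

lemma limsup_log_ge:
  assumes "C > 0" "\<And>n. n \<ge> 1 \<Longrightarrow> C * real n ^ m \<le> real (a n)"
  shows "ereal (real m) \<le> limsup (\<lambda>n. ereal (log (real n) (real (a n))))"
proof -
  have "(\<lambda>n. ereal (log (real n) (C * real n ^ m))) \<longlonglongrightarrow> ereal (real m)"
    using tendsto_log_monomial[of C m] assms(1) by (simp add: tendsto_ereal)
  then have "limsup (\<lambda>n. ereal (log (real n) (C * real n ^ m))) = ereal (real m)"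
    by (intro lim_imp_Limsup) simp_all
  moreover have "\<forall>\<^sub>F n in sequentially. ereal (log (real n) (C * real n ^ m)) \<le> ereal (log (real n) (real (a n)))"
    using eventually_gt_at_top[of 1]
  proof eventually_elim
    case (elim n)
    have "0 < C * real n ^ m" using assms(1) elim by simp
    then show ?case using elim assms(2)[of n] by simp
  qed
  ultimately show ?thesis using Limsup_mono by metis
qed
section \<open>The relatively free algebra of the graded Grassmann algebra\<close>

text \<open>
  The bound on the size of an independent subset of a span, in a form for families: here equal
  members at different indices have to be excluded, too.
\<close>
lemma (in vector_space) independent_family_length_le:
  assumes "finite B" "\<And>i. i < n \<Longrightarrow> v i \<in> span B"
    and indep: "\<And>c i. (\<Sum>i<n. c i *s v i) = 0 \<Longrightarrow> i < n \<Longrightarrow> c i = 0"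
  shows "n \<le> card B"
proof -
  have inj: "inj_on v {..<n}"
  proof (rule inj_onI, rule ccontr)
    fix i j assume ij: "i \<in> {..<n}" "j \<in> {..<n}" "v i = v j" "i \<noteq> j"
    \<comment> \<open>Two equal members satisfy the nontrivial relation with coefficients 1 and -1.\<close>
    let ?c = "\<lambda>l. if l = i then 1 else if l = j then - 1 else 0 :: 'a"
    have "(\<Sum>l<n. ?c l *s v l) = (\<Sum>l\<in>{i, j}. ?c l *s v l)"
      using ij by (intro sum.mono_neutral_right) auto
    also have "\<dots> = 0" using ij by simp
    finally show False using indep[of ?c i] ij by simp
  qed
  have "independent (v ` {..<n})"
  proof (rule independent_if_scalars_zero)
    fix f x assume "(\<Sum>x\<in>v ` {..<n}. f x *s x) = 0" "x \<in> v ` {..<n}"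
    then show "f x = 0" using indep[of "\<lambda>i. f (v i)"] by (auto simp: sum.reindex[OF inj])
  qed simp
  then have "card (v ` {..<n}) \<le> card B"
    using independent_span_bound[OF assms(1)] assms(2) by blast
  then show ?thesis by (simp add: card_image[OF inj])
qed

text \<open>
  Short names for the free algebra \<open>R\<close>, the ideal \<open>I\<close> of graded identities, the relatively free
  algebra \<open>S\<close> and its field of scalars \<open>K\<close>.
\<close>
locale relatively_free_grassmann =
  fixes k m :: nat
    and R :: "(gvar, 'a::field) free_algebra ring"
    and S :: "(gvar, 'a) free_algebra set ring"
    and I :: "(gvar, 'a) free_algebra set"
    and K :: "(gvar, 'a) free_algebra set set"
  assumes R_def: "R = free_algebra_ring (gvars m)"
    and I_def: "I = rel_ideal gscale (E_even k) (E_odd k) m"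
    and S_def: "S = rel_free gscale (E_even k) (E_odd k) m"
    and K_def: "K = rel_free_scalars gscale (E_even k) (E_odd k) m"
begin

definition cls :: "(gvar, 'a) free_algebra \<Rightarrow> (gvar, 'a) free_algebra set" where
  "cls f = I +>\<^bsub>R\<^esub> f"

definition scalar :: "'a \<Rightarrow> (gvar, 'a) free_algebra" where
  "scalar c = Poly_Mapping.single 0 c"

lemma ideal_I: "ideal I R"
  unfolding I_def R_def by (rule ideal_rel_ideal)

sublocale ring_hom_ring R S cls
proof -
  have "cls = (+>\<^bsub>R\<^esub>) I" by (rule ext) (simp add: cls_def)
  then show "ring_hom_ring R S cls"
    using ideal.rcos_ring_hom_ring[OF ideal_I] by (simp add: S_def rel_free_def flip: R_def I_def)
qed

lemma ops [simp]: "f \<oplus>\<^bsub>R\<^esub> g = f + g" "f \<otimes>\<^bsub>R\<^esub> g = f * g" "\<zero>\<^bsub>R\<^esub> = 0" "\<one>\<^bsub>R\<^esub> = 1"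
  by (simp_all add: R_def free_algebra_ring_def)

lemma carrier_R: "carrier R = {f. \<forall>w\<in>Poly_Mapping.keys f. set (letters w) \<subseteq> gvars m}"
  by (simp add: R_def free_algebra_ring_def)

lemma scalar_closed [simp]: "scalar c \<in> carrier R"
  by (auto simp: carrier_R scalar_def letters_zero)

lemma cls_eq_zero_iff: "f \<in> carrier R \<Longrightarrow> cls f = \<zero>\<^bsub>S\<^esub> \<longleftrightarrow> f \<in> I"
proof -
  assume f: "f \<in> carrier R"
  interpret ideal I R by (rule ideal_I)
  have "\<zero>\<^bsub>S\<^esub> = I" by (simp add: S_def rel_free_def FactRing_def flip: R_def I_def)
  then show ?thesis using f a_rcos_self[OF f] a_rcos_const[of f] by (auto simp: cls_def)
qed

lemma mem_I_iff:
  "f \<in> I \<longleftrightarrow> f \<in> carrier R \<and> (\<forall>\<rho>\<in>graded_subst k. poly_eval gscale \<rho> f = 0)"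
  by (auto simp: I_def rel_ideal_def T_Z2_def graded_subst_def R_def)

lemma carrier_S: "carrier S = cls ` carrier R"
  by (auto simp: S_def rel_free_def FactRing_def A_RCOSETS_def' cls_def simp flip: R_def I_def)

lemma K_eq: "K = range (\<lambda>c. cls (scalar c))"
  by (simp add: K_def rel_free_scalars_def cls_def scalar_def flip: R_def I_def)

lemma subfield_K: "subfield K S"
  unfolding K_def S_def by (rule subfield_rel_free_scalars)

lemma K_carrier: "K \<subseteq> carrier S"
  by (auto simp: K_eq)

lemma scalar_mem_I_iff: "scalar c \<in> I \<longleftrightarrow> c = 0"
proof
  assume "scalar c \<in> I"
  then have "poly_eval gscale (\<lambda>_. 0) (scalar c) = 0"
    using zero_graded_subst mem_I_iff by blast
  then show "c = 0" by (simp add: scalar_def poly_eval_single letters_zero gscale_one_eq_0_iff)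
next
  assume "c = 0"
  then show "scalar c \<in> I"
    using additive_subgroup.zero_closed[OF ideal.axioms(1)[OF ideal_I]] by (simp add: scalar_def)
qed

lemma sum_closed_R: "(\<And>i. i \<in> A \<Longrightarrow> f i \<in> carrier R) \<Longrightarrow> (\<Sum>i\<in>A. f i) \<in> carrier R"
proof (induction A rule: infinite_finite_induct)
  case (insert i A)
  then show ?case using R.a_closed[of "f i" "\<Sum>i\<in>A. f i"] by simp
qed (use R.zero_closed in simp_all)

lemma combine_R:
  "R.combine (map (\<lambda>i. scalar (c i)) [0..<length fs]) fs = (\<Sum>i<length fs. scalar (c i) * fs ! i)"
proof (induction fs arbitrary: c)
  case (Cons f fs)
  have "R.combine (map (\<lambda>i. scalar (c i)) [0..<length (f # fs)]) (f # fs)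
      = scalar (c 0) * f + R.combine (map (\<lambda>i. scalar (c (Suc i))) [0..<length fs]) fs"
    by (simp add: upt_conv_Cons map_Suc_upt[symmetric] comp_def del: upt_Suc map_Suc_upt)
  also have "\<dots> = (\<Sum>i<length (f # fs). scalar (c i) * (f # fs) ! i)"
    unfolding Cons.IH by (simp add: sum.lessThan_Suc_shift del: sum.lessThan_Suc)
  finally show ?case .
qed simp

lemma combine_cls:
  assumes "set fs \<subseteq> carrier R"
  shows "S.combine (map (\<lambda>i. cls (scalar (c i))) [0..<length fs]) (map cls fs)
    = cls (\<Sum>i<length fs. scalar (c i) * fs ! i)"
  using combine_hom[of "map (\<lambda>i. scalar (c i)) [0..<length fs]" fs] assms
  by (simp add: combine_R comp_def image_subset_iff)

text \<open>
  Linear independence in the relatively free algebra, expressed by graded identities with coefficients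
  in the base field. Both bounds on the dimension are derived from this criterion.
\<close>
lemma independent_cls_iff:
  assumes fs: "set fs \<subseteq> carrier R"
  shows "S.independent K (map cls fs) \<longleftrightarrow>
    (\<forall>c. (\<Sum>i<length fs. scalar (c i) * fs ! i) \<in> I \<longrightarrow> (\<forall>i<length fs. c i = 0))"
proof -
  let ?sum = "\<lambda>c. \<Sum>i<length fs. scalar (c i) * fs ! i"
  let ?Ks = "\<lambda>c. map (\<lambda>i. cls (scalar (c i))) [0..<length fs]"
  have closed: "?sum c \<in> carrier R" for c
  proof (rule sum_closed_R)
    fix i assume "i \<in> {..<length fs}"
    then have "fs ! i \<in> carrier R" using fs by auto
    then show "scalar (c i) * fs ! i \<in> carrier R" using R.m_closed[OF scalar_closed, of "fs ! i"] by simp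
  qed
  have zero_iff: "S.combine (?Ks c) (map cls fs) = \<zero>\<^bsub>S\<^esub> \<longleftrightarrow> ?sum c \<in> I" for c
    unfolding combine_cls[OF fs] by (rule cls_eq_zero_iff[OF closed])
  have trivial_iff: "set (?Ks c) \<subseteq> {\<zero>\<^bsub>S\<^esub>} \<longleftrightarrow> (\<forall>i<length fs. c i = 0)" for c
  proof -
    have "cls (scalar (c i)) = \<zero>\<^bsub>S\<^esub> \<longleftrightarrow> c i = 0" for i
      by (simp add: cls_eq_zero_iff scalar_mem_I_iff)
    then show ?thesis by (auto simp: image_subset_iff)
  qed
  have mem: "set (?Ks c) \<subseteq> K" for c by (auto simp: K_eq)
  show ?thesis
  proof (intro iffI allI impI)
    fix c i assume "S.independent K (map cls fs)" "?sum c \<in> I" "i < length fs"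
    then show "c i = 0"
      using S.independent_imp_trivial_combine[OF subfield_K _ mem, of "map cls fs" c] zero_iff[of c] trivial_iff[of c]
      by auto
  next
    assume *: "\<forall>c. ?sum c \<in> I \<longrightarrow> (\<forall>i<length fs. c i = 0)"
    have U: "set (map cls fs) \<subseteq> carrier S" using fs by auto
    show "S.independent K (map cls fs)"
    proof (rule S.trivial_combine_imp_independent[OF subfield_K U])
      fix Ks assume Ks: "set Ks \<subseteq> K" "S.combine Ks (map cls fs) = \<zero>\<^bsub>S\<^esub>"
      \<comment> \<open>Coefficient lists of any length are allowed in \<open>combine\<close>; truncation or padding by zeros gives one entry for each vector.\<close>
      obtain Ks' where Ks': "set (take (length (map cls fs)) Ks) \<subseteq> set Ks'"
        "set Ks' \<subseteq> set (take (length (map cls fs)) Ks) \<union> {\<zero>\<^bsub>S\<^esub>}"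
        "length Ks' = length (map cls fs)" "S.combine Ks' (map cls fs) = \<zero>\<^bsub>S\<^esub>"
        using S.combine_normalize[OF _ U Ks(2)] Ks(1) K_carrier by blast
      have "\<zero>\<^bsub>S\<^esub> \<in> K" using subfield_K by (simp add: S.subring_props(2))
      then have "set Ks' \<subseteq> K" using Ks'(2) Ks(1) by (auto dest: in_set_takeD)
      then have "\<forall>i<length fs. \<exists>c. Ks' ! i = cls (scalar c)"
        using Ks'(3) unfolding K_eq by (metis (no_types, lifting) imageE length_map nth_mem subsetD)
      then obtain c where c: "\<And>i. i < length fs \<Longrightarrow> Ks' ! i = cls (scalar (c i))" by metis
      then have eq: "Ks' = ?Ks c" using Ks'(3) by (intro nth_equalityI) simp_all
      have "set Ks' \<subseteq> {\<zero>\<^bsub>S\<^esub>}"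
        using zero_iff[of c] trivial_iff[of c] * Ks'(4) by (simp add: eq)
      then show "set (take (length (map cls fs)) Ks) \<subseteq> {\<zero>\<^bsub>S\<^esub>}" using Ks'(1) by blast
    qed
  qed
qed

definition deg_le :: "nat \<Rightarrow> (gvar, 'a) free_algebra set" where
  "deg_le n = {f \<in> carrier R. \<forall>w\<in>Poly_Mapping.keys f. length (letters w) \<le> n}"

lemma deg_le_closed: "deg_le n \<subseteq> carrier R"
  by (auto simp: deg_le_def)

lemma deg_le_mono: "n \<le> n' \<Longrightarrow> deg_le n \<subseteq> deg_le n'"
  by (auto simp: deg_le_def)

lemma deg_le_add: "f \<in> deg_le n \<Longrightarrow> g \<in> deg_le n \<Longrightarrow> f + g \<in> deg_le n"
  using R.a_closed[of f g] keys_add[of f g] by (auto simp: deg_le_def)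

lemma deg_le_mult:
  assumes "f \<in> deg_le n" "g \<in> deg_le n'"
  shows "f * g \<in> deg_le (n + n')"
proof -
  have "length (letters u) \<le> n + n'" if u: "u \<in> Poly_Mapping.keys (f * g)" for u
  proof -
    obtain v w where "v \<in> Poly_Mapping.keys f" "w \<in> Poly_Mapping.keys g" "u = v + w"
      using subsetD[OF keys_mult u] unfolding mem_Collect_eq by (elim exE conjE)
    then show ?thesis using assms by (auto simp: deg_le_def plus_word_def intro!: add_mono)
  qed
  then show ?thesis using assms R.m_closed[of f g] by (simp add: deg_le_def)
qed

lemma scalar_deg_le: "scalar c \<in> deg_le n"
  by (auto simp: deg_le_def letters_zero scalar_def carrier_R)

lemma one_eq_scalar: "1 = scalar 1"
  by (simp add: scalar_def)

lemma subalgebra_cls_deg_le: "subalgebra K (cls ` deg_le n) S"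
proof -
  have "subgroup (deg_le n) (add_monoid R)"
  proof (rule R.add.subgroupI)
    show "deg_le n \<noteq> {}" using scalar_deg_le by blast
    fix f assume f: "f \<in> deg_le n"
    then have "f \<oplus>\<^bsub>R\<^esub> - f = 0" "- f \<in> carrier R" by (auto simp: deg_le_def carrier_R in_keys_iff)
    then have "\<ominus>\<^bsub>R\<^esub> f = - f" using f deg_le_closed R.minus_equality[of "- f" f] by auto
    with f show "\<ominus>\<^bsub>R\<^esub> f \<in> deg_le n" by (auto simp: deg_le_def carrier_R in_keys_iff)
  qed (use deg_le_closed deg_le_add in auto)
  moreover have "scalar c * f \<in> deg_le n" if "f \<in> deg_le n" for c f
    using deg_le_mult[OF scalar_deg_le[of c 0] that] by simp
  ultimately have "subalgebra (range scalar) (deg_le n) R"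
    by (intro subalgebra.intro subalgebra_axioms.intro) auto
  moreover have "range scalar \<subseteq> carrier R" by auto
  ultimately have "subalgebra (cls ` range scalar) (cls ` deg_le n) S"
    by (intro img_is_subalgebra)
  then show ?thesis by (simp add: K_eq image_image)
qed

text \<open>
  The classes of the finitely many words of length at most \<open>n\<close> span. This crude bound makes
  the dimensions below meaningful; the sharp bound on them comes from the normal terms.
\<close>
lemma finite_dimension_cls_deg_le: "S.finite_dimension K (cls ` deg_le n)"
proof -
  have "finite {u. set u \<subseteq> gvars m \<and> length u \<le> n}"
    by (rule finite_lists_length_le) (simp add: gvars_def)
  from finite_list[OF this] obtain us where us: "set us = {u. set u \<subseteq> gvars m \<and> length u \<le> n}"
    by (rule exE)
  let ?mon = "\<lambda>u. Poly_Mapping.single (Word u) (1 :: 'a)"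
  let ?U = "map (\<lambda>u. cls (?mon u)) us"
  have mon: "?mon u \<in> carrier R" if "u \<in> set us" for u
    using that us by (auto simp: carrier_R)
  then have U: "set ?U \<subseteq> carrier S" by auto
  have "cls f \<in> S.Span K ?U" if f: "f \<in> deg_le n" for f
  proof -
    have "(\<Sum>w\<in>A. scalar (Poly_Mapping.lookup f w) * ?mon (letters w)) \<in> carrier R \<and>
        cls (\<Sum>w\<in>A. scalar (Poly_Mapping.lookup f w) * ?mon (letters w)) \<in> S.Span K ?U"
      if "A \<subseteq> Poly_Mapping.keys f" for A
      using finite_subset[OF that finite_keys] that
    proof (induction A rule: finite_induct)
      case empty
      show ?case using S.Span_subgroup_props(2)[OF subfield_K U] hom_zero R.zero_closed by simp
    next
      case (insert w A)
      let ?rest = "\<Sum>w\<in>A. scalar (Poly_Mapping.lookup f w) * ?mon (letters w)"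
      have w: "letters w \<in> set us" using insert.prems f us by (auto simp: deg_le_def carrier_R)
      have t: "scalar (Poly_Mapping.lookup f w) * ?mon (letters w) \<in> carrier R"
        using R.m_closed[OF scalar_closed mon[OF w]] by simp
      have "cls (?mon (letters w)) \<in> S.Span K ?U"
        using S.Span_base_incl[OF subfield_K U] w by auto
      then have "cls (scalar (Poly_Mapping.lookup f w)) \<otimes>\<^bsub>S\<^esub> cls (?mon (letters w)) \<in> S.Span K ?U"
        by (intro S.Span_smult_closed[OF subfield_K U]) (auto simp: K_eq)
      then have "cls (scalar (Poly_Mapping.lookup f w) * ?mon (letters w)) \<in> S.Span K ?U"
        using hom_mult[OF scalar_closed mon[OF w]] by simp
      moreover have rest: "?rest \<in> carrier R" "cls ?rest \<in> S.Span K ?U" using insert by auto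
      ultimately have "cls (scalar (Poly_Mapping.lookup f w) * ?mon (letters w) + ?rest) \<in> S.Span K ?U"
        using S.Span_subgroup_props(3)[OF subfield_K U] hom_add[OF t rest(1)] by simp
      moreover have "scalar (Poly_Mapping.lookup f w) * ?mon (letters w) + ?rest \<in> carrier R"
        using R.a_closed[OF t rest(1)] by simp
      ultimately show ?case using insert.hyps by simp
    qed
    moreover have "(\<Sum>w\<in>Poly_Mapping.keys f. scalar (Poly_Mapping.lookup f w) * ?mon (letters w)) = f"
      by (rule poly_mapping_eqI) (auto simp: scalar_def mult_single lookup_sum lookup_single when_def in_keys_iff)
    ultimately show ?thesis by fastforce
  qed
  then have "cls ` deg_le n \<subseteq> S.Span K ?U" by blast
  then show ?thesis
    using S.subalbegra_incl_imp_finite_dimension[OF subfield_K S.Span_finite_dimension[OF subfield_K U]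
        subalgebra_cls_deg_le] by blast
qed

text \<open>
  A polynomial is a graded identity if and only if its evaluation function vanishes. So independent
  classes have independent evaluation functions, and for degree at most \<open>n\<close> all of these lie in the span
  of the normal terms, whose number is at most \<open>D * (n + 1) ^ m\<close>.
\<close>
lemma independent_in_deg_le_length:
  assumes "CHAR('a) \<noteq> 2"
  obtains D where "\<And>n Us. S.independent K Us \<Longrightarrow> set Us \<subseteq> cls ` deg_le n \<Longrightarrow> length Us \<le> D * Suc n ^ m"
proof -
  obtain D where D: "\<And>n. finite (normal_terms k (gvar_list m) n :: ((gvar \<Rightarrow> 'a grassmann) \<Rightarrow> 'a grassmann) set)"
    "\<And>n. card (normal_terms k (gvar_list m) n :: ((gvar \<Rightarrow> 'a grassmann) \<Rightarrow> 'a grassmann) set) \<le> D * Suc n ^ m"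
    using normal_terms_finite_card[of k m, where 'a = 'a] by blast
  have "length Us \<le> D * Suc n ^ m" if Us: "S.independent K Us" "set Us \<subseteq> cls ` deg_le n" for n Us
  proof -
    have "Us \<in> lists (cls ` deg_le n)" using Us(2) by auto
    then obtain fs where fs: "Us = map cls fs" "set fs \<subseteq> deg_le n"
      unfolding lists_image by auto
    then have fsR: "set fs \<subseteq> carrier R" using deg_le_closed by blast
    let ?ev = "\<lambda>i \<rho>. if \<rho> \<in> graded_subst k then poly_eval gscale \<rho> (fs ! i) else 0"
    have "length fs \<le> card (normal_terms k (gvar_list m) n :: ((gvar \<Rightarrow> 'a grassmann) \<Rightarrow> 'a grassmann) set)"
    proof (rule fs.independent_family_length_le[OF D(1)])
      fix i assume "i < length fs"
      then have "fs ! i \<in> deg_le n" using fs(2) by auto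
      then show "?ev i \<in> fs.span (normal_terms k (gvar_list m) n)"
        by (intro poly_eval_in_span_normal_terms assms distinct_gvar_list)
           (auto simp: set_gvar_list deg_le_def carrier_R)
    next
      fix c i assume sum: "(\<Sum>i<length fs. fscale (c i) (?ev i)) = 0" and i: "i < length fs"
      have "(\<Sum>i<length fs. scalar (c i) * fs ! i) \<in> carrier R"
      proof (rule sum_closed_R)
        fix i assume "i \<in> {..<length fs}"
        then have "fs ! i \<in> carrier R" using fsR by auto
        then show "scalar (c i) * fs ! i \<in> carrier R" using R.m_closed[OF scalar_closed, of "fs ! i"] by simp
      qed
      moreover have "poly_eval gscale \<rho> (\<Sum>i<length fs. scalar (c i) * fs ! i) = 0" if "\<rho> \<in> graded_subst k" for \<rho>
        using fun_cong[OF sum, of \<rho>] that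
        by (simp add: sum_fun_apply fscale_def poly_eval_sum scalar_def poly_eval_const_mult)
      ultimately have "(\<Sum>i<length fs. scalar (c i) * fs ! i) \<in> I" by (simp add: mem_I_iff)
      then show "c i = 0" using Us(1) independent_cls_iff[OF fsR] i unfolding fs(1) by blast
    qed
    then show ?thesis using D(2)[of n] by (simp add: fs(1))
  qed
  then show thesis by (rule that)
qed

text \<open>
  Representatives of a basis have bounded degree. So the growth of any generating space is controlled by
  the filtration by degree, up to the constant factor \<open>d\<close> in the degree.
\<close>
lemma finite_dimension_in_deg_le:
  assumes "S.finite_dimension K V"
  obtains d where "V \<subseteq> cls ` deg_le d"
proof -
  obtain n where "S.dimension n K V" using assms by auto
  then obtain Us where Us: "set Us \<subseteq> carrier S" "S.Span K Us = V"
    using S.exists_base[OF subfield_K] by blast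
  have "\<exists>d. set Us \<subseteq> cls ` deg_le d" using Us(1)
  proof (induction Us)
    case (Cons u Us)
    then obtain d f where d: "set Us \<subseteq> cls ` deg_le d" and f: "f \<in> carrier R" "u = cls f"
      unfolding carrier_S by auto
    let ?e = "Max (insert d ((\<lambda>w. length (letters w)) ` Poly_Mapping.keys f))"
    have "f \<in> deg_le ?e" using f(1) by (auto simp: deg_le_def intro!: Max_ge)
    moreover have "deg_le d \<subseteq> deg_le ?e" by (intro deg_le_mono Max_ge) auto
    ultimately have "set (u # Us) \<subseteq> cls ` deg_le ?e"
      using d f(2) image_mono[of "deg_le d" "deg_le ?e" cls] by simp
    then show ?case ..
  qed simp
  then obtain d where "set Us \<subseteq> cls ` deg_le d" ..
  then have "V \<subseteq> cls ` deg_le d"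
    using S.subalgebra_Span_incl[OF subfield_K subalgebra_cls_deg_le] Us(2) by blast
  then show thesis by (rule that)
qed

lemma subalgebra_lin_span:
  assumes "X \<subseteq> carrier S"
  shows "subalgebra K (lin_span S K X) S"
proof -
  let ?A = "{W. subalgebra K W S \<and> X \<subseteq> W}"
  have "carrier S \<in> ?A" using assms S.carrier_is_subalgebra[OF K_carrier] by simp
  then have "subgroup (\<Inter>?A) (add_monoid S)"
    by (intro S.add.subgroups_Inter) (auto dest: subalgebra.axioms(1))
  then show ?thesis unfolding lin_span_def
    by (intro subalgebra.intro subalgebra_axioms.intro) (auto intro: subalgebra.smult_closed)
qed

lemma foldr_mult_in_deg_le:
  assumes "set vs \<subseteq> cls ` deg_le d" "length vs \<le> n"
  shows "foldr (\<otimes>\<^bsub>S\<^esub>) vs \<one>\<^bsub>S\<^esub> \<in> cls ` deg_le (d * n)"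
proof -
  have "foldr (\<otimes>\<^bsub>S\<^esub>) vs \<one>\<^bsub>S\<^esub> \<in> cls ` deg_le (d * length vs)" using assms(1)
  proof (induction vs)
    case Nil
    have "\<one>\<^bsub>S\<^esub> = cls (scalar 1)" using hom_one by (simp add: one_eq_scalar)
    then show ?case using scalar_deg_le by simp
  next
    case (Cons v vs)
    then obtain f g where f: "f \<in> deg_le d" "v = cls f"
      and g: "g \<in> deg_le (d * length vs)" "foldr (\<otimes>\<^bsub>S\<^esub>) vs \<one>\<^bsub>S\<^esub> = cls g" by auto
    have "f \<in> carrier R" "g \<in> carrier R" using f g deg_le_closed by auto
    then have "v \<otimes>\<^bsub>S\<^esub> cls g = cls (f * g)" using hom_mult[of f g] f(2) by simp
    then show ?case using deg_le_mult[OF f(1) g(1)] g(2) by simp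
  qed
  moreover have "deg_le (d * length vs) \<subseteq> deg_le (d * n)"
    using assms(2) by (intro deg_le_mono) simp
  ultimately show ?thesis by blast
qed

lemma power_sum_space_in_deg_le:
  assumes "V \<subseteq> cls ` deg_le d"
  shows "power_sum_space S K V n \<subseteq> cls ` deg_le (d * n)"
    and "subalgebra K (power_sum_space S K V n) S"
proof -
  let ?X = "{foldr (\<otimes>\<^bsub>S\<^esub>) vs \<one>\<^bsub>S\<^esub> | vs. set vs \<subseteq> V \<and> length vs \<le> n}"
  have X: "?X \<subseteq> cls ` deg_le (d * n)"
    using foldr_mult_in_deg_le assms by blast
  then show "power_sum_space S K V n \<subseteq> cls ` deg_le (d * n)"
    unfolding power_sum_space_def lin_span_def using subalgebra_cls_deg_le by blast
  have "?X \<subseteq> carrier S" using X deg_le_closed carrier_S by blast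
  then show "subalgebra K (power_sum_space S K V n) S"
    unfolding power_sum_space_def by (rule subalgebra_lin_span)
qed

lemma dimension_power_sum_space:
  assumes "V \<subseteq> cls ` deg_le d"
  shows "S.dimension ((S.dim over K) (power_sum_space S K V n)) K (power_sum_space S K V n)"
  by (rule S.finite_dimensionE[OF subfield_K S.subalbegra_incl_imp_finite_dimension[OF subfield_K
      finite_dimension_cls_deg_le power_sum_space_in_deg_le(2,1)[OF assms]]])

lemma GKdim_le:
  assumes "CHAR('a) \<noteq> 2"
  shows "GKdim S K \<le> ereal (real m)"
  unfolding GKdim_def
proof (rule SUP_least, unfold mem_Collect_eq)
  fix V assume "S.finite_dimension K V"
  then obtain d where d: "V \<subseteq> cls ` deg_le d" by (rule finite_dimension_in_deg_le)
  obtain D where D: "\<And>n Us. S.independent K Us \<Longrightarrow> set Us \<subseteq> cls ` deg_le n \<Longrightarrow> length Us \<le> D * Suc n ^ m"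
    using independent_in_deg_le_length[OF assms] by blast
  let ?dim = "\<lambda>n. (S.dim over K) (power_sum_space S K V n)"
  have "real (?dim n) \<le> real (Suc D * Suc d ^ m) * real n ^ m" if n: "n \<ge> 1" for n
  proof -
    obtain Us where "S.independent K Us" "length Us = ?dim n" "S.Span K Us = power_sum_space S K V n"
        "set Us \<subseteq> carrier S"
      using S.exists_base[OF subfield_K dimension_power_sum_space[OF d]] by blast
    then have "?dim n \<le> D * Suc (d * n) ^ m"
      using D[of Us "d * n"] S.Span_base_incl[OF subfield_K, of Us] power_sum_space_in_deg_le(1)[OF d, of n] by auto
    \<comment> \<open>Here \<open>d * n + 1 \<le> (d + 1) * n\<close>; and \<open>D + 1\<close> instead of \<open>D\<close> makes the constant factor at least \<open>1\<close>.\<close>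
    also have "\<dots> \<le> Suc D * (Suc d * n) ^ m"
      using n by (intro mult_mono power_mono) simp_all
    also have "\<dots> = Suc D * Suc d ^ m * n ^ m" by (simp only: power_mult_distrib mult.assoc)
    finally show ?thesis by (metis of_nat_le_iff of_nat_mult of_nat_power)
  qed
  moreover have "1 \<le> Suc D * Suc d ^ m" using mult_le_mono[of 1 "Suc D" 1 "Suc d ^ m"] by simp
  then have "1 \<le> real (Suc D * Suc d ^ m)" by (subst of_nat_1[symmetric], subst of_nat_le_iff)
  ultimately show "limsup (\<lambda>n. ereal (log (real n) (real (?dim n)))) \<le> ereal (real m)"
    by (intro limsup_log_le)
qed

lemma foldr_mult_letters:
  assumes "set u \<subseteq> gvars m"
  shows "foldr (\<otimes>\<^bsub>S\<^esub>) (map (\<lambda>x. cls (Poly_Mapping.single (Word [x]) 1)) u) \<one>\<^bsub>S\<^esub> = cls (Poly_Mapping.single (Word u) 1)"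
  using assms
proof (induction u)
  case Nil
  then show ?case using hom_one by (simp flip: zero_word_def)
next
  case (Cons x u)
  have "Poly_Mapping.single (Word [x]) 1 \<in> carrier R" "Poly_Mapping.single (Word u) 1 \<in> carrier R"
    using Cons.prems by (auto simp: carrier_R)
  from hom_mult[OF this] show ?case using Cons by (simp add: mult_single plus_word_def)
qed

lemma independent_digit_words:
  assumes "infinite (UNIV :: 'a set)"
  shows "S.independent K (map cls (map (\<lambda>s. Poly_Mapping.single (digit_word m q s) 1) [0..<q ^ m]))"
proof (subst independent_cls_iff)
  show "set (map (\<lambda>s. Poly_Mapping.single (digit_word m q s) 1) [0..<q ^ m]) \<subseteq> carrier R"
    using set_letters_digit_word by (auto simp: carrier_R intro: subsetD[OF set_letters_digit_word])
  let ?fs = "map (\<lambda>s. Poly_Mapping.single (digit_word m q s) (1 :: 'a)) [0..<q ^ m]"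
  show "\<forall>c. (\<Sum>i<length ?fs. scalar (c i) * ?fs ! i) \<in> I \<longrightarrow> (\<forall>i<length ?fs. c i = 0)"
  proof (intro allI impI)
    fix c i assume c: "(\<Sum>i<length ?fs. scalar (c i) * ?fs ! i) \<in> I" and i: "i < length ?fs"
    have "(\<Sum>s<q ^ m. c s * t ^ s) = 0" for t
    proof -
      have "0 = poly_eval gscale (power_subst q t) (\<Sum>i<length ?fs. scalar (c i) * ?fs ! i)"
        by (rule sym, rule bspec[OF conjunct2[OF c[unfolded mem_I_iff]] power_subst_graded])
      also have "\<dots> = (\<Sum>s<q ^ m. gscale (c s * t ^ s) 1)"
        by (simp add: poly_eval_sum scalar_def poly_eval_const_mult poly_eval_single prod_list_power_subst gscale_gscale)
      also have "\<dots> = gscale (\<Sum>s<q ^ m. c s * t ^ s) 1"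
        by (simp only: gscale_sum_left)
      finally show ?thesis using gscale_one_eq_0_iff[where 'a = 'a] by auto
    qed
    then show "c i = 0" using infinite_field_poly_zero[OF assms, of c "q ^ m" i] i by simp
  qed
qed

text \<open>
  For the span of \<open>1\<close> and the variables as generating space and \<open>q = n div m + 1\<close>, the \<open>q ^ m\<close> monomials
  with exponents below \<open>q\<close> have degree at most \<open>m * (q - 1) \<le> n\<close>, and \<open>q ^ m \<ge> (n / m) ^ m\<close>.
\<close>
lemma GKdim_ge:
  assumes "infinite (UNIV :: 'a set)" "m \<ge> 1"
  shows "ereal (real m) \<le> GKdim S K"
  unfolding GKdim_def
proof (rule SUP_upper2[of "cls ` deg_le 1"])
  let ?V = "cls ` deg_le 1"
  show "?V \<in> {V. S.finite_dimension K V}" using finite_dimension_cls_deg_le by simp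
  let ?dim = "\<lambda>n. (S.dim over K) (power_sum_space S K ?V n)"
  have "(1 / real m) ^ m * real n ^ m \<le> real (?dim n)" for n
  proof -
    let ?q = "Suc (n div m)"
    let ?Us = "map cls (map (\<lambda>s. Poly_Mapping.single (digit_word m ?q s) (1 :: 'a)) [0..<?q ^ m])"
    have "cls (Poly_Mapping.single (digit_word m ?q s) 1) \<in> power_sum_space S K ?V n" for s
    proof -
      let ?u = "letters (digit_word m ?q s)"
      have "length ?u \<le> m * (n div m)" using length_letters_digit_word[of ?q m s] by simp
      also have "\<dots> \<le> n" by simp
      finally have "length ?u \<le> n" .
      moreover have "set (map (\<lambda>x. cls (Poly_Mapping.single (Word [x]) 1)) ?u) \<subseteq> ?V"
        using set_letters_digit_word[of m ?q s] by (auto simp: deg_le_def carrier_R)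
      ultimately have "\<exists>vs. cls (Poly_Mapping.single (digit_word m ?q s) 1) = foldr (\<otimes>\<^bsub>S\<^esub>) vs \<one>\<^bsub>S\<^esub> \<and> set vs \<subseteq> ?V \<and> length vs \<le> n"
        using foldr_mult_letters[OF set_letters_digit_word]
        by (intro exI[of _ "map (\<lambda>x. cls (Poly_Mapping.single (Word [x]) 1)) ?u"]) simp
      then show ?thesis unfolding power_sum_space_def lin_span_def by blast
    qed
    then have "set ?Us \<subseteq> power_sum_space S K ?V n" by auto
    then have "length ?Us \<le> ?dim n"
      using S.independent_length_le_dimension[OF subfield_K dimension_power_sum_space[OF order_refl]
        independent_digit_words[OF assms(1)]] by blast
    then have "real (?q ^ m) \<le> real (?dim n)" by (simp del: of_nat_power)
    moreover have "real n / real m \<le> real ?q"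
    proof -
      have "n \<le> m * ?q" using assms(2) dividend_less_times_div[of m n] by simp
      then have "real n \<le> real (m * ?q)" by (simp only: of_nat_le_iff)
      then have "real n \<le> real m * real ?q" by (simp only: of_nat_mult)
      then show ?thesis using assms(2) by (simp add: field_simps)
    qed
    then have "(real n / real m) ^ m \<le> real (?q ^ m)" by (simp add: power_mono)
    ultimately show ?thesis by (simp add: power_divide)
  qed
  then show "ereal (real m) \<le> limsup (\<lambda>n. ereal (log (real n) (real (?dim n))))"
    using assms(2) by (intro limsup_log_ge[where C = "(1 / real m) ^ m"]) simp_all
qed

end

section \<open>The graded Gelfand-Kirillov dimension\<close>

theorem theorem6p2:
  fixes k p m :: nat
  assumes "prime p" and "p > 2" and "m \<ge> 1"
    and "infinite (UNIV :: 'a::field set)"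
    and "CHAR('a) = 0 \<or> CHAR('a) = p"
  shows "GKdim_Z2 (gscale :: 'a \<Rightarrow> 'a grassmann \<Rightarrow> 'a grassmann) (E_even k) (E_odd k) m = ereal (real m)"
proof -
  interpret relatively_free_grassmann k m "free_algebra_ring (gvars m) :: (gvar, 'a) free_algebra ring"
    "rel_free gscale (E_even k) (E_odd k) m" "rel_ideal gscale (E_even k) (E_odd k) m"
    "rel_free_scalars gscale (E_even k) (E_odd k) m"
    by unfold_locales (rule refl)+
  have "CHAR('a) \<noteq> 2" using assms(2,5) by auto
  then show ?thesis
    unfolding GKdim_Z2_def using GKdim_le GKdim_ge[OF assms(4,3)] by (intro antisym)
qed

end
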